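(* Let $\mathbf y=(t,y,y',y'')$, and assume that the third order differential equation $$F_3(\mathbf y)y'''+F_2(\mathbf y)y''+F_1(\mathbf y)y'+F_0(\mathbf y)=0$$ is not exact. Let $\alpha(t),\beta(y),\gamma(y'),\delta(y'')$ be differentiable functions and put $\xi=\xi(t,y,y',y'')=\alpha(t)\beta(y)\gamma(y')\delta(y'')$. Suppose that: (a) the six quotients $$\frac{F_{3t}(\mathbf y)-F_{0y''}(\mathbf y)}{\xi_{y''}F_0(\mathbf y)-\xi_tF_3(\mathbf y)},\quad \frac{F_{2t}(\mathbf y)-F_{0y'}(\mathbf y)}{\xi_{y'}F_0(\mathbf y)-\xi_tF_2(\mathbf y)},\quad \frac{F_{1t}(\mathbf y)-F_{0y}(\mathbf y)}{\xi_yF_0(\mathbf y)-\xi_tF_1(\mathbf y)},$$ $$\frac{F_{1y'}(\mathbf y)-F_{2y}(\mathbf y)}{\xi_yF_2(\mathbf y)-\xi_{y'}F_1(\mathbf y)},\quad \frac{F_{1y''}(\mathbf y)-F_{2y}(\mathbf y)}{\xi_yF_2(\mathbf y)-\xi_{y''}F_1(\mathbf y)},\quad \frac{F_{2y''}(\mathbf y)-F_{3y'}(\mathbf y)}{\xi_{y''}F_2(\mathbf y)-\xi_{y'}F_3(\mathbf y)}$$ are functions of $\xi=\alpha(t)\beta(y)\gamma(y')\delta(y'')$; and (b) these six quotients are all equal to each other. Then the equation admits an integrating factor of the form $\mu(\xi)=\mu(\alpha(t)\beta(y)\gamma(y')\delta(y''))$. Moreover, the integrating factor is given by $$\mu(\xi)=\exp\left\{\int\frac{F_{3t}(\mathbf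 y)-F_{0y''}(\mathbf y)}{\xi_{y''}F_0(\mathbf y)-\xi_tF_3(\mathbf y)}\,d\xi\right\}.$$
   Context: The functions $F_0,F_1,F_2,F_3$ of $\mathbf y=(t,y,y',y'')$ are continuous together with their first partial derivatives with respect to $t,y,y',y''$ on some simply connected domain $\mathcal R$ in $\mathbb R^4$. Subscripts $t,y,y',y''$ denote partial derivatives, e.g. $F_{3t}=\partial_tF_3$, $F_{0y''}=\partial_{y''}F_0$, $\xi_{y'}=\partial_{y'}\xi$. The equation $F_3y'''+F_2y''+F_1y'+F_0=0$ is called exact if there is a differentiable function $\Psi(t,y,y',y'')$ whose total derivative $\frac{d}{dt}\Psi$ equals its left-hand side. An integrating factor is a function $\mu(t,y,y',y'')$ such that multiplying the equation by $\mu$ makes it exact. In the formula for $\mu$, the quotient is regarded as a function of $\xi$ and integrated with respect to $\xi$.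
   Formalization: The fifth quotient is corrected to (F_{1y''}-F_{3y})/(ξ_yF_3-ξ_{y''}F_1) and the sixth denominator to ξ_{y'}F_3-ξ_{y''}F_2 (opposite sign), since the claim is false as printed; all six denominators are explicitly assumed nonzero on the domain. *)

theory Defs
  imports "HOL-Analysis.Analysis"
begin

text \<open>Points of \<open>R^4\<close> are quadruples \<open>(t, y, y', y'')\<close>; in names and bound variables
  \<open>y1\<close> stands for \<open>y'\<close>, \<open>y2\<close> for \<open>y''\<close> and \<open>y3\<close> for \<open>y'''\<close>.\<close>

type_synonym jet = "real \<times> real \<times> real \<times> real"

definition D_t :: "(jet \<Rightarrow> real) \<Rightarrow> jet \<Rightarrow> real" where
  "D_t f = (\<lambda>(t, y, y1, y2). deriv (\<lambda>s. f (s, y, y1, y2)) t)"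

definition D_y :: "(jet \<Rightarrow> real) \<Rightarrow> jet \<Rightarrow> real" where
  "D_y f = (\<lambda>(t, y, y1, y2). deriv (\<lambda>s. f (t, s, y1, y2)) y)"

definition D_y1 :: "(jet \<Rightarrow> real) \<Rightarrow> jet \<Rightarrow> real" where
  "D_y1 f = (\<lambda>(t, y, y1, y2). deriv (\<lambda>s. f (t, y, s, y2)) y1)"

definition D_y2 :: "(jet \<Rightarrow> real) \<Rightarrow> jet \<Rightarrow> real" where
  "D_y2 f = (\<lambda>(t, y, y1, y2). deriv (\<lambda>s. f (t, y, y1, s)) y2)"

text \<open>The partial derivatives are required to exist explicitly, because \<^const>\<open>deriv\<close> is total.\<close>

definition C1_on :: "jet set \<Rightarrow> (jet \<Rightarrow> real) \<Rightarrow> bool" where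
  "C1_on R f \<longleftrightarrow>
     continuous_on R f \<and>
     (\<forall>(t, y, y1, y2) \<in> R.
        (\<lambda>s. f (s, y, y1, y2)) differentiable at t \<and>
        (\<lambda>s. f (t, s, y1, y2)) differentiable at y \<and>
        (\<lambda>s. f (t, y, s, y2)) differentiable at y1 \<and>
        (\<lambda>s. f (t, y, y1, s)) differentiable at y2) \<and>
     continuous_on R (D_t f) \<and> continuous_on R (D_y f) \<and>
     continuous_on R (D_y1 f) \<and> continuous_on R (D_y2 f)"

text \<open>By the chain rule, this is \<open>d/dt \<Psi>(t, y(t), y'(t), y''(t))\<close> as a function of the point
  and of \<open>y3 = y'''(t)\<close>.\<close>

definition total_deriv :: "(jet \<Rightarrow> real) \<Rightarrow> jet \<Rightarrow> real \<Rightarrow> real" where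
  "total_deriv \<Psi> = (\<lambda>(t, y, y1, y2) y3.
     D_t \<Psi> (t, y, y1, y2) + D_y \<Psi> (t, y, y1, y2) * y1
     + D_y1 \<Psi> (t, y, y1, y2) * y2 + D_y2 \<Psi> (t, y, y1, y2) * y3)"

definition ode_lhs ::
  "(jet \<Rightarrow> real) \<Rightarrow> (jet \<Rightarrow> real) \<Rightarrow> (jet \<Rightarrow> real) \<Rightarrow> (jet \<Rightarrow> real) \<Rightarrow> jet \<Rightarrow> real \<Rightarrow> real" where
  "ode_lhs F0 F1 F2 F3 = (\<lambda>(t, y, y1, y2) y3.
     F3 (t, y, y1, y2) * y3 + F2 (t, y, y1, y2) * y2 + F1 (t, y, y1, y2) * y1 + F0 (t, y, y1, y2))"

definition exact_ode ::
  "jet set \<Rightarrow> (jet \<Rightarrow> real) \<Rightarrow> (jet \<Rightarrow> real) \<Rightarrow> (jet \<Rightarrow> real) \<Rightarrow> (jet \<Rightarrow> real) \<Rightarrow> bool" where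
  "exact_ode R F0 F1 F2 F3 \<longleftrightarrow>
     (\<exists>\<Psi>. \<Psi> differentiable_on R \<and>
          (\<forall>x\<in>R. \<forall>y3. total_deriv \<Psi> x y3 = ode_lhs F0 F1 F2 F3 x y3))"

definition integrating_factor ::
  "jet set \<Rightarrow> (jet \<Rightarrow> real) \<Rightarrow> (jet \<Rightarrow> real) \<Rightarrow> (jet \<Rightarrow> real) \<Rightarrow> (jet \<Rightarrow> real)
     \<Rightarrow> (jet \<Rightarrow> real) \<Rightarrow> bool" where
  "integrating_factor R F0 F1 F2 F3 \<mu> \<longleftrightarrow>
     exact_ode R (\<lambda>x. \<mu> x * F0 x) (\<lambda>x. \<mu> x * F1 x) (\<lambda>x. \<mu> x * F2 x) (\<lambda>x. \<mu> x * F3 x)"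

definition function_of :: "jet set \<Rightarrow> (jet \<Rightarrow> real) \<Rightarrow> (jet \<Rightarrow> real) \<Rightarrow> bool" where
  "function_of R \<xi> q \<longleftrightarrow> (\<exists>g :: real \<Rightarrow> real. \<forall>x\<in>R. q x = g (\<xi> x))"

text \<open>\<open>G\<close> is an indefinite integral with respect to \<open>\<xi>\<close> of the quantity \<open>q\<close>, regarded as a
  function of \<open>\<xi>\<close>.\<close>

definition indefinite_integral_wrt ::
  "jet set \<Rightarrow> (jet \<Rightarrow> real) \<Rightarrow> (jet \<Rightarrow> real) \<Rightarrow> (real \<Rightarrow> real) \<Rightarrow> bool" where
  "indefinite_integral_wrt R \<xi> q G \<longleftrightarrow> (\<forall>x\<in>R. (G has_real_derivative q x) (at (\<xi> x)))"

text \<open>Numerators and denominators of the six quotients. With the indices \<open>0, 1, 2, 3\<close>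
  corresponding to \<open>t, y, y', y''\<close>, the pair for \<open>i < j\<close> is obtained by solving
  \<open>\<partial>\<^sub>i (\<mu>(\<xi>) F\<^sub>j) = \<partial>\<^sub>j (\<mu>(\<xi>) F\<^sub>i)\<close> for \<open>\<mu>'(\<xi>) / \<mu>(\<xi>)\<close>. The usual printed form of the last two has
  misprints, which are corrected here: \<open>F\<^sub>2\<close> in place of \<open>F\<^sub>3\<close> (in \<open>\<partial>\<^sub>yF\<^sub>3\<close> and in \<open>\<xi>\<^sub>y F\<^sub>3\<close>) for
  the pair \<open>1, 3\<close>, and the opposite sign of the denominator for the pair \<open>2, 3\<close>. With either
  misprint the quotient conditions do not imply that \<open>\<mu>(\<xi>)\<close> is an integrating factor.\<close>

definition quotient_terms ::
  "(jet \<Rightarrow> real) \<Rightarrow> (jet \<Rightarrow> real) \<Rightarrow> (jet \<Rightarrow> real) \<Rightarrow> (jet \<Rightarrow> real) \<Rightarrow> (jet \<Rightarrow> real)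
     \<Rightarrow> ((jet \<Rightarrow> real) \<times> (jet \<Rightarrow> real)) set" where
  "quotient_terms F0 F1 F2 F3 \<xi> =
    {(\<lambda>x. D_t F3 x - D_y2 F0 x,  \<lambda>x. D_y2 \<xi> x * F0 x - D_t \<xi> x * F3 x),
     (\<lambda>x. D_t F2 x - D_y1 F0 x,  \<lambda>x. D_y1 \<xi> x * F0 x - D_t \<xi> x * F2 x),
     (\<lambda>x. D_t F1 x - D_y F0 x,   \<lambda>x. D_y \<xi> x * F0 x - D_t \<xi> x * F1 x),
     (\<lambda>x. D_y1 F1 x - D_y F2 x,  \<lambda>x. D_y \<xi> x * F2 x - D_y1 \<xi> x * F1 x),
     (\<lambda>x. D_y2 F1 x - D_y F3 x,  \<lambda>x. D_y \<xi> x * F3 x - D_y2 \<xi> x * F1 x),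
     (\<lambda>x. D_y2 F2 x - D_y1 F3 x, \<lambda>x. D_y1 \<xi> x * F3 x - D_y2 \<xi> x * F2 x)}"

end

theory Submission
  imports Defs
begin

text \<open>
  Write \<open>\<omega> = F\<^sub>0 dt + F\<^sub>1 dy + F\<^sub>2 dy' + F\<^sub>3 dy''\<close>. The equation is exact as soon as \<open>\<omega>\<close> has a
  potential \<open>\<Psi>\<close>, and on a simply connected domain closedness of \<open>\<omega>\<close> provides one. If \<open>q\<close> is the
  common value of the six quotients, the equations \<open>n = q d\<close> say that
  \<open>\<partial>\<^sub>i F\<^sub>j + q \<xi>\<^sub>i F\<^sub>j = \<partial>\<^sub>j F\<^sub>i + q \<xi>\<^sub>j F\<^sub>i\<close> for all \<open>i < j\<close>. For \<open>\<mu> = exp (G \<circ> \<xi>)\<close> with \<open>G' = q\<close>,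
  where \<open>q\<close> is read as a function of \<open>\<xi>\<close>, the product rule turns them into the closedness of
  \<open>\<mu> \<omega>\<close>. Two points need more than this calculation.

  \<^item> The functions \<open>\<alpha>, \<beta>, \<gamma>, \<delta>\<close> are only differentiable, so the coefficients of \<open>\<mu> \<omega>\<close> are
    differentiable but need not be \<open>C\<^sup>1\<close>, and the usual Poincare lemma (differentiation under the
    integral sign) does not apply. Instead, Goursat's subdivision argument shows that a merely
    differentiable vector field with symmetric derivative has vanishing integral over every
    triangle (\<open>goursat_symmetric_derivative\<close>). Line integrals along segments are therefore
    additive on small balls, and a locally additive function of two points on a simply connected
    open set is locally a difference \<open>\<Psi> y - \<Psi> x\<close> (\<open>locally_additive_integrates\<close>); this \<open>\<Psi>\<close> is the
    potential.

  \<^item> An indefinite integral \<open>G\<close> has to exist. Writing \<open>q = g \<circ> \<xi>\<close>, this follows once \<open>\<xi>\<close> has an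
    open interval as its range and \<open>g\<close> is continuous there, although \<open>q\<close> involves derivatives
    of \<open>\<xi>\<close> that may be discontinuous. The key is that \<open>\<partial>\<^sub>j \<xi>\<close> depends on the variable \<open>x\<^sub>i\<close> with
    \<open>i \<noteq> j\<close> only through a continuous factor: a quotient without \<open>\<partial>\<^sub>i \<xi>\<close> in its denominator
    is continuous along lines in direction \<open>x\<^sub>i\<close>, and if \<open>\<partial>\<^sub>i \<xi> \<noteq> 0\<close> at a point, the values of
    \<open>\<xi>\<close> on such a line through it cover a neighbourhood of the value there
    (\<open>indefinite_integral_exists\<close>).
\<close>

section \<open>Integrating locally additive functions of two points\<close>

text \<open>The model is \<open>J a b = \<Psi> b - \<Psi> a\<close>, or the integral of a closed 1-form along the segment
  from \<open>a\<close> to \<open>b\<close>.\<close>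

definition locally_additive :: "'a::metric_space set \<Rightarrow> ('a \<Rightarrow> 'a \<Rightarrow> real) \<Rightarrow> bool" where
  "locally_additive S J \<longleftrightarrow>
     (\<forall>x\<in>S. \<exists>e>0. \<forall>a\<in>ball x e. \<forall>b\<in>ball x e. \<forall>c\<in>ball x e. J a b + J b c = J a c)"

text \<open>A Riemann sum of \<open>J\<close> along \<open>p\<close>. If \<open>J\<close> is locally additive on a set that contains the
  path, it is the same for all large \<open>N\<close>, and it replaces the integral of a closed 1-form
  along a path that is only continuous.\<close>

definition chain_sum :: "('a \<Rightarrow> 'a \<Rightarrow> real) \<Rightarrow> nat \<Rightarrow> (real \<Rightarrow> 'a) \<Rightarrow> real" where
  "chain_sum J N p = (\<Sum>i<N. J (p (real i / real N)) (p (real (Suc i) / real N)))"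

text \<open>Lebesgue's number lemma for the open cover of \<open>C\<close> by sets on whose image \<open>J\<close> is additive.
  It makes the radius uniform, for paths (\<open>C = [0,1]\<close>) and homotopies (\<open>C = [0,1]\<^sup>2\<close>) alike.\<close>

lemma locally_additive_pullback:
  fixes h :: "'c::metric_space \<Rightarrow> 'a::metric_space"
  assumes J: "locally_additive S J" and C: "compact C" and h: "continuous_on C h" "h ` C \<subseteq> S"
  obtains d where "d > 0"
    "\<And>x u v w. \<lbrakk>x \<in> C; u \<in> C \<inter> ball x d; v \<in> C \<inter> ball x d; w \<in> C \<inter> ball x d\<rbrakk>
       \<Longrightarrow> J (h u) (h v) + J (h v) (h w) = J (h u) (h w)"
proof -
  define G where "G = {U. open U \<and> (\<forall>u\<in>C\<inter>U. \<forall>v\<in>C\<inter>U. \<forall>w\<in>C\<inter>U.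
                              J (h u) (h v) + J (h v) (h w) = J (h u) (h w))}"
  have "C \<subseteq> \<Union>G"
  proof
    fix x assume x: "x \<in> C"
    have "h x \<in> S" using x h(2) by blast
    then obtain e where e: "e > 0"
      "\<And>a b c. \<lbrakk>a\<in>ball (h x) e; b\<in>ball (h x) e; c\<in>ball (h x) e\<rbrakk> \<Longrightarrow> J a b + J b c = J a c"
      using bspec[OF J[unfolded locally_additive_def], of "h x"] by blast
    obtain d where d: "d > 0" "\<And>y. y \<in> C \<Longrightarrow> dist y x < d \<Longrightarrow> dist (h y) (h x) < e"
      using h(1) x e(1) unfolding continuous_on_iff by blast
    have "ball x d \<in> G"
      unfolding G_def using d(2) by (auto simp: dist_commute intro!: e(2))
    with d(1) show "x \<in> \<Union>G" by (meson Union_iff centre_in_ball)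
  qed
  then obtain d where d: "d > 0" "\<And>x. x \<in> C \<Longrightarrow> \<exists>U\<in>G. ball x d \<subseteq> U"
    using Heine_Borel_lemma[OF C, of G] G_def by blast
  show ?thesis
  proof (rule that[OF d(1)])
    fix x u v w
    assume "x \<in> C" "u \<in> C \<inter> ball x d" "v \<in> C \<inter> ball x d" "w \<in> C \<inter> ball x d"
    then show "J (h u) (h v) + J (h v) (h w) = J (h u) (h w)"
      using d(2)[of x] unfolding G_def by blast
  qed
qed

text \<open>Once the mesh is below the Lebesgue number, each coarse step and its subdivision lie in
  one set on which \<open>J\<close> is additive, so the sum over the subdivision telescopes to the coarse
  step.\<close>

lemma chain_sum_refine:
  assumes J: "locally_additive S J" and p: "path p" "path_image p \<subseteq> S"
  shows "\<forall>\<^sub>F N in sequentially. \<forall>M>0. chain_sum J (N * M) p = chain_sum J N p"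
proof -
  obtain d where d: "d > 0" and add:
    "\<And>x u v w. \<lbrakk>x \<in> {0..1}; u \<in> {0..1} \<inter> ball x d; v \<in> {0..1} \<inter> ball x d; w \<in> {0..1} \<inter> ball x d\<rbrakk>
       \<Longrightarrow> J (p u) (p v) + J (p v) (p w) = J (p u) (p w)"
    by (rule locally_additive_pullback[OF J compact_Icc[of 0 1], of p])
       (use p in \<open>auto simp: path_def path_image_def\<close>)
  have "\<forall>\<^sub>F N in sequentially. 1 / real N < d \<and> N > 0"
    using order_tendstoD(2)[OF lim_const_over_n[of 1] d] eventually_gt_at_top[of 0]
    by eventually_elim simp
  then show ?thesis
  proof (eventually_elim, intro allI impI)
    fix N M :: nat assume N: "1 / real N < d \<and> N > 0" and M: "M > 0"
    define P where "P j = p (real j / real (N * M))" for j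
    have block: "(\<Sum>j\<in>{i*M..<i*M+M}. J (P j) (P (Suc j))) = J (P (i*M)) (P (i*M+M))"
      if i: "i < N" for i
    proof -
      have near: "real j / real (N*M) \<in> {0..1} \<inter> ball (real (i*M) / real (N*M)) d"
        if "i*M \<le> j" "j \<le> i*M+M" for j
      proof -
        have "i*M+M \<le> N*M" using i by (metis Suc_leI add.commute mult_Suc mult_le_mono1)
        then have "real j \<le> real (N*M)" using that by (simp only: of_nat_le_iff)
        then have 1: "real j / real (N*M) \<in> {0..1}" using N M by (simp add: field_simps)
        have "\<bar>real j - real (i*M)\<bar> \<le> real M"
          using that by (simp only: of_nat_diff[symmetric] abs_of_nat of_nat_le_iff)
        then have "\<bar>real j / real (N*M) - real (i*M) / real (N*M)\<bar> \<le> real M / real (N*M)"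
          by (simp only: diff_divide_distrib[symmetric] abs_divide abs_of_nat divide_right_mono of_nat_0_le_iff)
        also have "\<dots> = 1 / real N" using M N by (simp add: field_simps)
        finally show ?thesis using 1 N by (auto simp: dist_real_def abs_minus_commute)
      qed
      have add': "J (P (i*M)) (P j) + J (P j) (P k) = J (P (i*M)) (P k)"
        if "i*M \<le> j" "j \<le> i*M+M" "i*M \<le> k" "k \<le> i*M+M" for j k
        unfolding P_def using that near[of "i*M"] near[of j] near[of k]
        by (intro add[of "real (i*M) / real (N*M)"]) auto
      have "(\<Sum>j\<in>{i*M..<i*M+M}. J (P j) (P (Suc j)))
          = (\<Sum>j\<in>{i*M..<i*M+M}. J (P (i*M)) (P (Suc j)) - J (P (i*M)) (P j))"
        by (intro sum.cong refl) (use add' in \<open>force simp: algebra_simps\<close>)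
      also have "\<dots> = J (P (i*M)) (P (i*M+M)) - J (P (i*M)) (P (i*M))"
        by (rule sum_Suc_diff') simp
      also have "J (P (i*M)) (P (i*M)) = 0" using add'[of "i*M" "i*M"] by simp
      finally show ?thesis by simp
    qed
    have "chain_sum J (N*M) p = (\<Sum>j<N*M. J (P j) (P (Suc j)))"
      unfolding chain_sum_def P_def ..
    also have "\<dots> = (\<Sum>i<N. \<Sum>j\<in>{i*M..<i*M+M}. J (P j) (P (Suc j)))"
      by (rule sum.nat_group[symmetric])
    also have "\<dots> = (\<Sum>i<N. J (P (i*M)) (P (i*M+M)))"
      using block by (intro sum.cong) auto
    also have "\<dots> = chain_sum J N p"
    proof -
      have "P (i*M) = p (real i / real N)" for i
        unfolding P_def using M by simp
      moreover have "i*M+M = Suc i * M" for i by simp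
      ultimately show ?thesis unfolding chain_sum_def by (simp del: mult_Suc)
    qed
    finally show "chain_sum J (N * M) p = chain_sum J N p" .
  qed
qed

text \<open>Two large numbers of steps \<open>N\<close> and \<open>M\<close> have the common refinement \<open>N * M\<close>, so the sums are
  eventually constant.\<close>

lemma chain_sum_convergent:
  assumes "locally_additive S J" "path p" "path_image p \<subseteq> S"
  shows "convergent (\<lambda>N. chain_sum J N p)"
proof -
  obtain K where K: "\<And>N M. N \<ge> K \<Longrightarrow> M > 0 \<Longrightarrow> chain_sum J (N * M) p = chain_sum J N p"
    using chain_sum_refine[OF assms] unfolding eventually_sequentially by blast
  have "chain_sum J N p = chain_sum J (Suc K) p" if "N \<ge> Suc K" for N
    using K[of N "Suc K"] K[of "Suc K" N] that by (simp add: mult.commute)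
  then have "(\<lambda>N. chain_sum J N p) \<longlonglongrightarrow> chain_sum J (Suc K) p"
    by (intro tendsto_eventually eventually_sequentiallyI[of "Suc K"])
  then show ?thesis by (rule convergentI)
qed

text \<open>Cut the square of the homotopy into cells so small that \<open>J\<close> is additive on the image of
  each. The four edges of a cell then cancel, so passing from one row of the grid to the
  next changes the sum only by the contribution of the two vertical sides, which is zero
  because the end points are fixed.\<close>

lemma chain_sum_homotopic:
  assumes J: "locally_additive S J" and hom: "homotopic_paths S p q"
  shows "\<forall>\<^sub>F N in sequentially. chain_sum J N p = chain_sum J N q"
proof -
  obtain h where h: "continuous_on ({0..1} \<times> {0..1::real}) h" "h \<in> ({0..1} \<times> {0..1}) \<rightarrow> S"
    and h0: "\<And>x. x \<in> {0..1} \<Longrightarrow> h (0, x) = p x" and h1: "\<And>x. x \<in> {0..1} \<Longrightarrow> h (1, x) = q x"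
    and ends: "\<And>t. t \<in> {0..1::real} \<Longrightarrow> h (t, 0) = p 0" "\<And>t. t \<in> {0..1::real} \<Longrightarrow> h (t, 1) = p 1"
    using hom unfolding homotopic_paths by (force simp: pathstart_def pathfinish_def)
  obtain d where d: "d > 0" and add:
    "\<And>x u v w. \<lbrakk>x \<in> {0..1} \<times> {0..1}; u \<in> ({0..1} \<times> {0..1}) \<inter> ball x d;
        v \<in> ({0..1} \<times> {0..1}) \<inter> ball x d; w \<in> ({0..1} \<times> {0..1}) \<inter> ball x d\<rbrakk>
       \<Longrightarrow> J (h u) (h v) + J (h v) (h w) = J (h u) (h w)"
    by (rule locally_additive_pullback[OF J compact_Times[OF compact_Icc compact_Icc] h(1)])
       (use h(2) in auto)
  have "\<forall>\<^sub>F N in sequentially. 2 / real N < d \<and> N > 0"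
    using order_tendstoD(2)[OF lim_const_over_n[of 2] d] eventually_gt_at_top[of 0]
    by eventually_elim simp
  then show ?thesis
  proof eventually_elim
    fix N :: nat assume N: "2 / real N < d \<and> N > 0"
    define x where "x j i = (real j / real N, real i / real N)" for j i
    define P where "P j i = h (x j i)" for j i
    have x_in: "x j i \<in> {0..1} \<times> {0..1}" if "j \<le> N" "i \<le> N" for j i
      using that N by (auto simp: x_def field_simps)
    have x_ball: "x (j + a) (i + b) \<in> ball (x j i) d" if "a \<le> 1" "b \<le> 1" for j i a b
    proof -
      have "dist (x j i) (x (j + a) (i + b)) \<le> \<bar>real a / real N\<bar> + \<bar>real b / real N\<bar>"
        unfolding dist_norm x_def using norm_Pair_le[of "- real a / real N" "- real b / real N"]
        by (simp add: add_divide_distrib)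
      also have "\<dots> \<le> 2 / real N" using that by (simp add: add_divide_distrib[symmetric] divide_right_mono)
      finally show ?thesis using N by simp
    qed
    have tri: "J (P (j+a) (i+b)) (P (j+a') (i+b')) + J (P (j+a') (i+b')) (P (j+a'') (i+b''))
             = J (P (j+a) (i+b)) (P (j+a'') (i+b''))"
      if "j < N" "i < N" "a \<le> 1" "b \<le> 1" "a' \<le> 1" "b' \<le> 1" "a'' \<le> 1" "b'' \<le> 1"
      for j i a b a' b' a'' b''
      unfolding P_def using that x_ball by (intro add[of "x j i"] IntI x_in) auto
    \<comment> \<open>The cells are indexed by their corner with \<open>i < N\<close>, so \<open>i = N\<close> is reached from the cell
      with corner \<open>N - 1\<close>.\<close>
    have refl0: "J (P j i) (P j i) = 0" if "j < N" "i \<le> N" for j i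
    proof (cases "i < N")
      case True then show ?thesis using tri[of j i 0 0 0 0 0 0] that by simp
    next
      case False
      then have "i = N" using that by simp
      then show ?thesis using tri[of j "N - 1" 0 1 0 1 0 1] that N by simp
    qed
    have row: "(\<Sum>i<N. J (P (Suc j) i) (P (Suc j) (Suc i))) = (\<Sum>i<N. J (P j i) (P j (Suc i)))"
      if j: "j < N" for j
    proof -
      \<comment> \<open>Both ways around the cell from its lower left to its upper right corner give the same sum.\<close>
      have "J (P (Suc j) i) (P (Suc j) (Suc i)) - J (P j i) (P j (Suc i))
          = J (P j (Suc i)) (P (Suc j) (Suc i)) - J (P j i) (P (Suc j) i)" if "i < N" for i
        using tri[of j i 0 0 0 1 1 1] tri[of j i 0 0 1 0 1 1] j that by simp
      then have "(\<Sum>i<N. J (P (Suc j) i) (P (Suc j) (Suc i))) - (\<Sum>i<N. J (P j i) (P j (Suc i)))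
          = (\<Sum>i<N. J (P j (Suc i)) (P (Suc j) (Suc i)) - J (P j i) (P (Suc j) i))"
        by (simp add: sum_subtractf[symmetric])
      also have "\<dots> = J (P j N) (P (Suc j) N) - J (P j 0) (P (Suc j) 0)"
        by (rule sum_lessThan_telescope)
      also have "\<dots> = 0"
      proof -
        have "P (Suc j) N = P j N" "P (Suc j) 0 = P j 0"
          using j N ends by (auto simp: P_def x_def field_simps)
        then show ?thesis using refl0 j by simp
      qed
      finally show ?thesis by simp
    qed
    have "(\<Sum>i<N. J (P j i) (P j (Suc i))) = (\<Sum>i<N. J (P 0 i) (P 0 (Suc i)))" if "j \<le> N" for j
      using that by (induction j) (auto simp: row)
    from this[of N] have "(\<Sum>i<N. J (P N i) (P N (Suc i))) = (\<Sum>i<N. J (P 0 i) (P 0 (Suc i)))"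
      by simp
    moreover have "P 0 i = p (real i / real N)" "P N i = q (real i / real N)" if "i \<le> N" for i
      using that N h0 h1 by (auto simp: P_def x_def field_simps)
    ultimately show "chain_sum J N p = chain_sum J N q"
      unfolding chain_sum_def by (simp add: Suc_le_eq)
  qed
qed

lemma chain_sum_joinpaths:
  assumes "pathfinish p = pathstart q"
  shows "chain_sum J (2 * N) (p +++ q) = chain_sum J N p + chain_sum J N q"
proof (cases "N = 0")
  case False
  define r where "r i = (p +++ q) (real i / real (2 * N))" for i
  have left: "r i = p (real i / real N)" if "i \<le> N" for i
    using that False by (simp add: r_def joinpaths_def field_simps)
  have right: "r (N + i) = q (real i / real N)" if "i \<le> N" for i
  proof (cases "i = 0")
    case True then show ?thesis
      using left[of N] False assms by (simp add: pathfinish_def pathstart_def)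
  next
    case i: False
    then have "\<not> real (N + i) / real (2 * N) \<le> 1/2"
      using False by (simp add: field_simps)
    moreover have "2 * (real (N + i) / real (2 * N)) - 1 = real i / real N"
      using False by (simp add: field_simps)
    ultimately show ?thesis unfolding r_def joinpaths_def by (simp only: if_False)
  qed
  have split: "(\<Sum>i<a + b. f i) = (\<Sum>i<a. f i) + (\<Sum>i<b. f (a + i))" for f :: "nat \<Rightarrow> real" and a b
    by (induction b) simp_all
  have "chain_sum J (2 * N) (p +++ q) = (\<Sum>i<N + N. J (r i) (r (Suc i)))"
    unfolding chain_sum_def r_def mult_2 ..
  also have "\<dots> = (\<Sum>i<N. J (r i) (r (Suc i))) + (\<Sum>i<N. J (r (N + i)) (r (N + Suc i)))"
    by (simp only: split add_Suc_right)
  also have "\<dots> = chain_sum J N p + chain_sum J N q"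
    unfolding chain_sum_def
    by (intro arg_cong2[of _ _ _ _ "(+)"] sum.cong refl arg_cong2[of _ _ _ _ J] left right) auto
  finally show ?thesis .
qed (simp add: chain_sum_def)

lemma chain_sum_linepath:
  fixes x y :: "'a::real_normed_vector"
  assumes add: "\<And>a b c. \<lbrakk>a \<in> ball x e; b \<in> ball x e; c \<in> ball x e\<rbrakk> \<Longrightarrow> J a b + J b c = J a c"
    and y: "y \<in> ball x e" and N: "N > 0"
  shows "chain_sum J N (linepath x y) = J x y"
proof -
  have e: "x \<in> ball x e" using y le_less_trans[OF zero_le_dist] by (simp del: zero_le_dist)
  have in_ball: "linepath x y (real i / real N) \<in> ball x e" if "i \<le> N" for i
    using linepath_in_convex_hull[of x "ball x e" y "real i / real N"] e y that N
    by (simp add: convex_ball hull_same field_simps)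
  have "chain_sum J N (linepath x y)
      = (\<Sum>i<N. J x (linepath x y (real (Suc i) / real N)) - J x (linepath x y (real i / real N)))"
    unfolding chain_sum_def
    using add[OF e in_ball in_ball] by (intro sum.cong refl) (simp add: eq_diff_eq add.commute del: of_nat_Suc)
  also have "\<dots> = J x y - J x x"
    using N by (subst sum_lessThan_telescope) (simp add: linepath_def)
  also have "J x x = 0" using add[OF e e e] by simp
  finally show ?thesis by simp
qed

text \<open>As in the construction of a primitive, \<open>\<Psi> x\<close> is the limiting sum of \<open>J\<close> along any path
  from a base point to \<open>x\<close>. Simple connectedness makes the path from the base point to \<open>y\<close>
  homotopic to the path to \<open>x\<close> followed by the segment from \<open>x\<close> to \<open>y\<close>, which contributes
  \<open>J x y\<close>.\<close>

theorem locally_additive_integrates: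
  fixes S :: "'a::real_normed_vector set"
  assumes S: "open S" "simply_connected S" and J: "locally_additive S J"
  obtains \<Psi> where "\<And>x. x \<in> S \<Longrightarrow> \<exists>e>0. \<forall>y\<in>ball x e. \<Psi> y - \<Psi> x = J x y"
proof (cases "S = {}")
  case False
  then obtain z where z: "z \<in> S" by blast
  have "\<exists>g. path g \<and> path_image g \<subseteq> S \<and> pathstart g = z \<and> pathfinish g = x" if "x \<in> S" for x
    using simply_connected_imp_path_connected[OF S(2)] z that unfolding path_connected_def by blast
  then obtain g where g: "\<And>x. x \<in> S \<Longrightarrow> path (g x)" "\<And>x. x \<in> S \<Longrightarrow> path_image (g x) \<subseteq> S"
    "\<And>x. x \<in> S \<Longrightarrow> pathstart (g x) = z" "\<And>x. x \<in> S \<Longrightarrow> pathfinish (g x) = x"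
    by metis
  define \<Psi> where "\<Psi> x = lim (\<lambda>N. chain_sum J N (g x))" for x
  have lim: "(\<lambda>N. chain_sum J N (g x)) \<longlonglongrightarrow> \<Psi> x" if "x \<in> S" for x
    unfolding \<Psi>_def using chain_sum_convergent[OF J] g that by (simp add: convergent_LIMSEQ_iff)
  show ?thesis
  proof (rule that[of \<Psi>])
    fix x assume x: "x \<in> S"
    obtain e1 where e1: "e1 > 0" "ball x e1 \<subseteq> S" using S(1) x open_contains_ball by blast
    obtain e2 where e2: "e2 > 0"
      "\<And>a b c. \<lbrakk>a\<in>ball x e2; b\<in>ball x e2; c\<in>ball x e2\<rbrakk> \<Longrightarrow> J a b + J b c = J a c"
      using J x unfolding locally_additive_def by meson
    have "\<Psi> y - \<Psi> x = J x y" if y: "y \<in> ball x (min e1 e2)" for y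
    proof -
      have yS: "y \<in> S" and y2: "y \<in> ball x e2" using y e1 by auto
      have seg: "path_image (linepath x y) \<subseteq> S"
        using y e1 closed_segment_subset[of x "ball x e1" y] by (auto simp: convex_ball)
      let ?q = "g x +++ linepath x y"
      have "homotopic_paths S (g y) ?q"
        using S(2)[unfolded simply_connected_eq_homotopic_paths] g x yS seg
        by (simp add: path_image_join)
      then have "\<forall>\<^sub>F N in sequentially. chain_sum J N (g y) = chain_sum J N ?q"
        by (rule chain_sum_homotopic[OF J])
      then have "\<forall>\<^sub>F N in sequentially. chain_sum J (2 * N) (g y) = chain_sum J (2 * N) ?q"
        by (rule eventually_compose_filterlim) (rule filterlim_subseq, simp add: strict_mono_def)
      then have "\<forall>\<^sub>F N in sequentially. chain_sum J (2 * N) (g y) = chain_sum J N (g x) + J x y"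
        using eventually_gt_at_top[of 0]
      proof eventually_elim
        fix N :: nat assume "chain_sum J (2 * N) (g y) = chain_sum J (2 * N) ?q" and "N > 0"
        then show "chain_sum J (2 * N) (g y) = chain_sum J N (g x) + J x y"
          using chain_sum_joinpaths[of "g x" "linepath x y" J N] g(4)[OF x]
            chain_sum_linepath[of x e2 J, OF e2(2) y2, of N] by simp
      qed
      moreover have "(\<lambda>N. chain_sum J (2 * N) (g y)) \<longlonglongrightarrow> \<Psi> y"
        by (rule filterlim_compose[OF lim[OF yS]]) (rule filterlim_subseq, simp add: strict_mono_def)
      ultimately have "(\<lambda>N. chain_sum J N (g x) + J x y) \<longlonglongrightarrow> \<Psi> y"
        by (rule Lim_transform_eventually[rotated])
      moreover have "(\<lambda>N. chain_sum J N (g x) + J x y) \<longlonglongrightarrow> \<Psi> x + J x y"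
        by (intro tendsto_intros lim x)
      ultimately have "\<Psi> y = \<Psi> x + J x y" by (rule LIMSEQ_unique)
      then show ?thesis by simp
    qed
    then show "\<exists>e>0. \<forall>y\<in>ball x e. \<Psi> y - \<Psi> x = J x y"
      using e1 e2 by (intro exI[of _ "min e1 e2"]) auto
  qed
qed auto

section \<open>Line integrals and Goursat's theorem for symmetric derivatives\<close>

definition line_int :: "('a::real_inner \<Rightarrow> 'a) \<Rightarrow> 'a \<Rightarrow> 'a \<Rightarrow> real" where
  "line_int V a b = integral {0..1} (\<lambda>s. V (linepath a b s) \<bullet> (b - a))"

lemma continuous_on_line_int_integrand:
  assumes "continuous_on S V" "closed_segment a b \<subseteq> S"
  shows "continuous_on {0..1} (\<lambda>s. V (linepath a b s) \<bullet> (b - a))"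
proof -
  have "continuous_on (linepath a b ` {0..1}) V"
    using assms by (simp add: linepath_image_01 continuous_on_subset)
  then have "continuous_on {0..1} (\<lambda>s. V (linepath a b s))"
    using continuous_on_compose2[of _ V "{0..1}" "linepath a b"] by auto
  then show ?thesis by (intro continuous_intros)
qed

lemma line_int_bound:
  assumes V: "continuous_on S V" "closed_segment a b \<subseteq> S"
    and B: "\<And>y. y \<in> closed_segment a b \<Longrightarrow> norm (V y) \<le> B"
  shows "\<bar>line_int V a b\<bar> \<le> B * norm (b - a)"
proof -
  have "norm (integral {0..1} (\<lambda>s. V (linepath a b s) \<bullet> (b - a))) \<le> B * norm (b - a) * (1 - 0)"
  proof (rule integral_bound)
    fix s :: real assume "s \<in> {0..1}"
    then have "norm (V (linepath a b s)) \<le> B" by (intro B linepath_in_path)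
    then show "norm (V (linepath a b s) \<bullet> (b - a)) \<le> B * norm (b - a)"
      using Cauchy_Schwarz_ineq2[of "V (linepath a b s)" "b - a"]
      by (smt (verit, best) mult_right_mono norm_ge_zero real_norm_def)
  qed (use continuous_on_line_int_integrand[OF V] in auto)
  then show ?thesis by (simp add: line_int_def)
qed

lemma line_int_diff:
  assumes "continuous_on S V" "continuous_on S W" "closed_segment a b \<subseteq> S"
  shows "line_int (\<lambda>y. V y - W y) a b = line_int V a b - line_int W a b"
  unfolding line_int_def inner_diff_left
  by (intro Henstock_Kurzweil_Integration.integral_diff integrable_continuous_real
      continuous_on_line_int_integrand[where S=S] assms)

lemma line_int_gradient:
  assumes "\<And>y. y \<in> closed_segment a b \<Longrightarrow> (q has_derivative (\<lambda>h. V y \<bullet> h)) (at y)"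
  shows "line_int V a b = q b - q a"
proof -
  have "((\<lambda>s. V (linepath a b s) \<bullet> (b - a)) has_integral
          (q (linepath a b 1) - q (linepath a b 0))) {0..1}"
  proof (rule fundamental_theorem_of_calculus)
    fix s :: real assume s: "s \<in> {0..1}"
    have "((\<lambda>s. q (linepath a b s)) has_derivative (\<lambda>h. V (linepath a b s) \<bullet> (h *\<^sub>R (b - a))))
            (at s within {0..1})"
      unfolding linepath_def using assms[OF linepath_in_path[OF s, of a b]]
      by (intro has_derivative_compose[where g=q and f="\<lambda>s. (1 - s) *\<^sub>R a + s *\<^sub>R b"])
         (auto intro!: derivative_eq_intros simp: linepath_def algebra_simps)
    then show "((\<lambda>s. q (linepath a b s)) has_vector_derivative V (linepath a b s) \<bullet> (b - a))
            (at s within {0..1})"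
      by (simp add: has_vector_derivative_def)
  qed simp
  then show ?thesis by (simp add: line_int_def integral_unique linepath_def)
qed

text \<open>The fundamental theorem of calculus for the restriction of \<open>V\<close> to a segment. Reversal and
  subdivision of segments are special cases.\<close>

lemma line_int_subsegment:
  assumes V: "continuous_on S V" "closed_segment a b \<subseteq> S"
  obtains F where "\<And>s t. \<lbrakk>s \<in> {0..1}; t \<in> {0..1}\<rbrakk>
    \<Longrightarrow> line_int V (linepath a b s) (linepath a b t) = F t - F s"
proof -
  obtain F :: "real \<Rightarrow> real" where F: "\<And>x. x \<in> {0..1} \<Longrightarrow>
      (F has_vector_derivative V (linepath a b x) \<bullet> (b - a)) (at x within {0..1})"
    using antiderivative_continuous[OF continuous_on_line_int_integrand[OF V]] by blast
  show ?thesis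
  proof (rule that[of F])
    fix s t :: real assume st: "s \<in> {0..1}" "t \<in> {0..1}"
    let ?l = "linepath s t"
    have l: "?l r \<in> {0..1}" if "r \<in> {0..1}" for r
      using linepath_in_convex_hull[of s "{0..1}" t r] st that by (simp add: hull_same)
    have "((\<lambda>r. V (linepath a b (?l r)) \<bullet> (b - a) * (t - s)) has_integral (F (?l 1) - F (?l 0))) {0..1}"
    proof (rule fundamental_theorem_of_calculus)
      fix r :: real assume r: "r \<in> {0..1}"
      have "(F has_vector_derivative V (linepath a b (?l r)) \<bullet> (b - a)) (at (?l r) within ?l ` {0..1})"
        by (rule has_vector_derivative_within_subset[OF F[OF l[OF r]]]) (use l in blast)
      moreover have "(?l has_vector_derivative (t - s)) (at r within {0..1})"
        unfolding linepath_def has_vector_derivative_def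
        by (auto intro!: derivative_eq_intros simp: algebra_simps)
      ultimately have "((F \<circ> ?l) has_vector_derivative (t - s) *\<^sub>R (V (linepath a b (?l r)) \<bullet> (b - a)))
          (at r within {0..1})"
        by (intro vector_diff_chain_within)
      then show "((\<lambda>r. F (?l r)) has_vector_derivative V (linepath a b (?l r)) \<bullet> (b - a) * (t - s))
          (at r within {0..1})"
        by (simp add: o_def mult.commute)
    qed simp
    then have "integral {0..1} (\<lambda>r. V (linepath a b (?l r)) \<bullet> (b - a) * (t - s)) = F t - F s"
      by (simp add: integral_unique linepath_def del: integral_mult_left)
    moreover have "linepath (linepath a b s) (linepath a b t) r = linepath a b (?l r)" for r
      by (simp add: linepath_def algebra_simps)
    moreover have "linepath a b t - linepath a b s = (t - s) *\<^sub>R (b - a)"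
      by (simp add: linepath_def algebra_simps)
    ultimately show "line_int V (linepath a b s) (linepath a b t) = F t - F s"
      unfolding line_int_def by (simp add: mult.commute)
  qed
qed

lemma line_int_reverse:
  assumes "continuous_on S V" "closed_segment a b \<subseteq> S"
  shows "line_int V b a = - line_int V a b"
proof -
  obtain F where F: "\<And>s t. \<lbrakk>s \<in> {0..1}; t \<in> {0..1}\<rbrakk>
    \<Longrightarrow> line_int V (linepath a b s) (linepath a b t) = F t - F s"
    using line_int_subsegment[OF assms] by blast
  show ?thesis using F[of 0 1] F[of 1 0] by (simp add: linepath_def)
qed

lemma line_int_midpoint:
  assumes "continuous_on S V" "closed_segment a b \<subseteq> S"
  shows "line_int V a b = line_int V a (midpoint a b) + line_int V (midpoint a b) b"
proof -
  obtain F where F: "\<And>s t. \<lbrakk>s \<in> {0..1}; t \<in> {0..1}\<rbrakk>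
    \<Longrightarrow> line_int V (linepath a b s) (linepath a b t) = F t - F s"
    using line_int_subsegment[OF assms] by blast
  have "linepath a b (1/2) = midpoint a b"
    by (simp add: linepath_def midpoint_def scaleR_add_right)
  then show ?thesis using F[of 0 1] F[of 0 "1/2"] F[of "1/2" 1] by (simp add: linepath_def)
qed

definition triangle_int :: "('a::real_inner \<Rightarrow> 'a) \<Rightarrow> 'a \<Rightarrow> 'a \<Rightarrow> 'a \<Rightarrow> real" where
  "triangle_int V a b c = line_int V a b + line_int V b c + line_int V c a"

text \<open>The midpoints of the sides cut the triangle into four similar ones of half the size. Each
  inner side is traversed once in either direction, so the integrals over the four pieces
  add up to the whole, and one piece carries at least a quarter of it.\<close>

lemma triangle_int_quarter:
  assumes V: "continuous_on S V" and S: "convex hull {a, b, c} \<subseteq> S"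
    and sides: "norm (b - a) \<le> d" "norm (c - b) \<le> d" "norm (a - c) \<le> d"
  obtains a' b' c' where "convex hull {a', b', c'} \<subseteq> convex hull {a, b, c}"
    "norm (b' - a') \<le> d / 2" "norm (c' - b') \<le> d / 2" "norm (a' - c') \<le> d / 2"
    "\<bar>triangle_int V a b c\<bar> \<le> 4 * \<bar>triangle_int V a' b' c'\<bar>"
proof -
  let ?H = "convex hull {a, b, c}"
  define x y z where "x = midpoint a b" and "y = midpoint b c" and "z = midpoint c a"
  have H: "a \<in> ?H" "b \<in> ?H" "c \<in> ?H" by (auto intro: hull_inc)
  have seg: "closed_segment u v \<subseteq> S" if "u \<in> ?H" "v \<in> ?H" for u v
    using closed_segment_subset[OF that convex_convex_hull] S by blast
  have mid: "midpoint u v \<in> ?H" if "u \<in> ?H" "v \<in> ?H" for u v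
    using closed_segment_subset[OF that convex_convex_hull] midpoint_in_closed_segment by blast
  have H': "x \<in> ?H" "y \<in> ?H" "z \<in> ?H" unfolding x_def y_def z_def using mid H by auto
  have half: "norm (w :: 'a) \<le> d / 2" if "w + w = u" "norm u \<le> d" for w u
  proof -
    have "w = (1/2) *\<^sub>R u" using that(1) by (simp flip: that(1) scaleR_2)
    then show ?thesis using that(2) by simp
  qed
  have dbl: "x + x = a + b" "y + y = b + c" "z + z = c + a"
    by (simp_all add: x_def y_def z_def flip: midpoint_eq_iff)
  have twice: "x - a + (x - a) = b - a" "b - x + (b - x) = b - a" "y - b + (y - b) = c - b" "c - y + (c - y) = c - b" "z - c + (z - c) = a - c" "a - z + (a - z) = a - c" "z - x + (z - x) = c - b" "x - y + (x - y) = a - c" "y - z + (y - z) = b - a"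
    using dbl by (simp_all add: algebra_simps)
  have small: "norm (x - a) \<le> d / 2" "norm (b - x) \<le> d / 2" "norm (y - b) \<le> d / 2"
      "norm (c - y) \<le> d / 2" "norm (z - c) \<le> d / 2" "norm (a - z) \<le> d / 2"
      "norm (z - x) \<le> d / 2" "norm (x - y) \<le> d / 2" "norm (y - z) \<le> d / 2"
    using sides half[of "x - a" "b - a"]
      half[of "b - x" "b - a"]
      half[of "y - b" "c - b"]
      half[of "c - y" "c - b"]
      half[of "z - c" "a - c"]
      half[of "a - z" "a - c"]
      half[of "z - x" "c - b"]
      half[of "x - y" "a - c"]
      half[of "y - z" "b - a"]
    by (simp_all add: twice)
  have "triangle_int V a b c = triangle_int V a x z + triangle_int V x b y + triangle_int V y c z
          + triangle_int V x y z"
    unfolding triangle_int_def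
    using line_int_midpoint[OF V seg, of a b] line_int_midpoint[OF V seg, of b c]
      line_int_midpoint[OF V seg, of c a] line_int_reverse[OF V seg, of x y]
      line_int_reverse[OF V seg, of y z] line_int_reverse[OF V seg, of z x] H H'
    by (simp flip: x_def y_def z_def)
  then have "\<bar>triangle_int V a b c\<bar> \<le> 4 * \<bar>triangle_int V a x z\<bar>
      \<or> \<bar>triangle_int V a b c\<bar> \<le> 4 * \<bar>triangle_int V x b y\<bar>
      \<or> \<bar>triangle_int V a b c\<bar> \<le> 4 * \<bar>triangle_int V y c z\<bar>
      \<or> \<bar>triangle_int V a b c\<bar> \<le> 4 * \<bar>triangle_int V x y z\<bar>" by linarith
  moreover have "convex hull {u, v, w} \<subseteq> ?H" if "u \<in> ?H" "v \<in> ?H" "w \<in> ?H" for u v w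
    using that by (intro hull_minimal) auto
  ultimately show ?thesis
    using that[of a x z] that[of x b y] that[of y c z] that[of x y z] H H' small
    by (metis norm_minus_commute)
qed

text \<open>An affine field with symmetric linear part is the gradient of a quadratic polynomial. This
  is the only place where the symmetry of the derivative enters Goursat's argument.\<close>

lemma triangle_int_affine:
  assumes L: "bounded_linear L" "\<And>u v. L u \<bullet> v = L v \<bullet> u"
  shows "triangle_int (\<lambda>y. k + L (y - x)) a b c = 0"
proof -
  interpret L: bounded_linear L by fact
  define q where "q y = k \<bullet> (y - x) + (L (y - x) \<bullet> (y - x)) / 2" for y
  have q: "(q has_derivative (\<lambda>h. (k + L (y - x)) \<bullet> h)) (at y)" for y
    unfolding q_def
    by (auto intro!: derivative_eq_intros L.has_derivative simp: inner_add_left L(2))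
  show ?thesis
    unfolding triangle_int_def using line_int_gradient[OF q] by simp
qed

text \<open>By \<open>triangle_int_affine\<close> only the remainder of the first-order expansion at \<open>x\<close>
  contributes. It is at most \<open>e\<close> times the distance to \<open>x\<close>, which is bounded by \<open>2 * d\<close>, on
  three sides of length at most \<open>d\<close>.\<close>

lemma triangle_int_small:
  assumes V: "continuous_on S V" and S: "convex hull {a, b, c} \<subseteq> S"
    and x: "x \<in> convex hull {a, b, c}"
    and L: "bounded_linear L" "\<And>u v. L u \<bullet> v = L v \<bullet> u"
    and r: "\<And>y. y \<in> convex hull {a, b, c} \<Longrightarrow> norm (V y - V x - L (y - x)) \<le> e * norm (y - x)"
    and sides: "norm (b - a) \<le> d" "norm (c - b) \<le> d" "norm (a - c) \<le> d"
    and e: "e \<ge> 0"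
  shows "\<bar>triangle_int V a b c\<bar> \<le> 6 * e * d\<^sup>2"
proof -
  let ?H = "convex hull {a, b, c}"
  let ?W = "\<lambda>y. V x + L (y - x)"
  interpret L: bounded_linear L by fact
  have H: "a \<in> ?H" "b \<in> ?H" "c \<in> ?H" by (auto intro: hull_inc)
  have d: "d \<ge> 0" using sides(1) norm_ge_zero order_trans by blast
  have cb: "?H \<subseteq> cball a d"
    using sides d by (intro hull_minimal) (auto simp: dist_norm norm_minus_commute)
  have near: "norm (y - x) \<le> 2 * d" if "y \<in> ?H" for y
  proof -
    have "dist a y \<le> d" "dist a x \<le> d" using cb that x by auto
    then show ?thesis using dist_triangle3[of y x a] by (simp add: dist_norm)
  qed
  have W: "continuous_on S ?W" by (intro continuous_intros L.continuous_on)
  have side: "\<bar>line_int (\<lambda>y. V y - ?W y) u v\<bar> \<le> 2 * e * d * d"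
    if "u \<in> ?H" "v \<in> ?H" "norm (v - u) \<le> d" for u v
  proof -
    have sg: "closed_segment u v \<subseteq> ?H" using that by (intro closed_segment_subset convex_convex_hull)
    have "\<bar>line_int (\<lambda>y. V y - ?W y) u v\<bar> \<le> (e * (2 * d)) * norm (v - u)"
    proof (rule line_int_bound)
      show "continuous_on S (\<lambda>y. V y - ?W y)" by (intro continuous_intros V W)
      show "closed_segment u v \<subseteq> S" using sg S by blast
      fix y assume "y \<in> closed_segment u v"
      then have y: "y \<in> ?H" using sg by blast
      have "norm (V y - ?W y) \<le> e * norm (y - x)" using r[OF y] by (simp add: algebra_simps)
      also have "\<dots> \<le> e * (2 * d)" using near[OF y] e by (rule mult_left_mono)
      finally show "norm (V y - ?W y) \<le> e * (2 * d)" .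
    qed
    also have "\<dots> \<le> (e * (2 * d)) * d" using that(3) e d by (intro mult_left_mono) auto
    finally show ?thesis by (simp add: algebra_simps)
  qed
  have seg: "closed_segment u v \<subseteq> S" if "u \<in> ?H" "v \<in> ?H" for u v
    using closed_segment_subset[OF that convex_convex_hull] S by blast
  have "triangle_int V a b c = triangle_int (\<lambda>y. V y - ?W y) a b c + triangle_int ?W a b c"
    unfolding triangle_int_def using line_int_diff[OF V W seg] H by simp
  also have "triangle_int ?W a b c = 0" by (rule triangle_int_affine[OF L])
  finally have "triangle_int V a b c = triangle_int (\<lambda>y. V y - ?W y) a b c" by simp
  then show ?thesis
    unfolding triangle_int_def using side[of a b] side[of b c] side[of c a] H sides
    by (simp add: power2_eq_square)
qed

text \<open>Goursat's argument in place of Stokes' theorem, which would require a continuous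
  derivative. Repeated quartering gives triangles of size \<open>d / 2 ^ n\<close> with integral at least
  \<open>T / 4 ^ n\<close> that shrink to a point \<open>x\<close>. Differentiability at \<open>x\<close> alone makes these
  integrals \<open>o((d / 2 ^ n)\<^sup>2)\<close>, so \<open>T = 0\<close>.\<close>

theorem goursat_symmetric_derivative:
  fixes V :: "'a::euclidean_space \<Rightarrow> 'a"
  assumes der: "\<And>x. x \<in> S \<Longrightarrow> (V has_derivative V' x) (at x)"
    and sym: "\<And>x u v. x \<in> S \<Longrightarrow> V' x u \<bullet> v = V' x v \<bullet> u"
    and S: "convex hull {a, b, c} \<subseteq> S"
  shows "triangle_int V a b c = 0"
proof -
  define T where "T = \<bar>triangle_int V a b c\<bar>"
  define d where "d = norm (b - a) + norm (c - b) + norm (a - c)"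
  have V: "continuous_on S V"
    using der has_derivative_continuous continuous_at_imp_continuous_on by blast
  define P where "P n t = (case t of (a', b', c') \<Rightarrow>
      convex hull {a', b', c'} \<subseteq> S \<and> T / 4 ^ n \<le> \<bar>triangle_int V a' b' c'\<bar> \<and>
      norm (b' - a') \<le> d / 2 ^ n \<and> norm (c' - b') \<le> d / 2 ^ n \<and> norm (a' - c') \<le> d / 2 ^ n)"
    for n and t :: "'a \<times> 'a \<times> 'a"
  define H where "H t = (case t of (a', b', c') \<Rightarrow> convex hull {a', b', c'})"
    for t :: "'a \<times> 'a \<times> 'a"
  have "\<exists>f. \<forall>n. P n (f n) \<and> H (f (Suc n)) \<subseteq> H (f n)"
  proof (rule dependent_nat_choice)
    show "\<exists>t. P 0 t"
      using S by (intro exI[of _ "(a, b, c)"]) (simp add: P_def T_def d_def)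
    fix t n assume t: "P n t"
    obtain a1 b1 c1 where t1: "t = (a1, b1, c1)" by (cases t)
    obtain a2 b2 c2 where t2: "convex hull {a2, b2, c2} \<subseteq> convex hull {a1, b1, c1}"
      "norm (b2 - a2) \<le> d / 2 ^ n / 2" "norm (c2 - b2) \<le> d / 2 ^ n / 2" "norm (a2 - c2) \<le> d / 2 ^ n / 2"
      "\<bar>triangle_int V a1 b1 c1\<bar> \<le> 4 * \<bar>triangle_int V a2 b2 c2\<bar>"
      using triangle_int_quarter[OF V, of a1 b1 c1 "d / 2 ^ n"] t unfolding P_def t1 by auto
    have "T / 4 ^ n \<le> \<bar>triangle_int V a1 b1 c1\<bar>" using t unfolding P_def t1 by simp
    then have "T / 4 ^ n / 4 \<le> \<bar>triangle_int V a2 b2 c2\<bar>" using t2(5) by simp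
    then have "T / 4 ^ Suc n \<le> \<bar>triangle_int V a2 b2 c2\<bar>" by (simp add: mult.commute)
    then have "P (Suc n) (a2, b2, c2)"
      using t t2(1-4) unfolding P_def t1 by (auto simp: mult.commute)
    then show "\<exists>t'. P (Suc n) t' \<and> H t' \<subseteq> H t"
      using t2(1) unfolding H_def t1 by (intro exI[of _ "(a2, b2, c2)"]) simp
  qed
  then obtain f where f: "\<And>n. P n (f n)" "\<And>n. H (f (Suc n)) \<subseteq> H (f n)" by blast
  obtain x where x: "\<And>n. x \<in> H (f n)"
  proof (rule bounded_closed_nest[of "\<lambda>n. H (f n)"])
    have "compact (H (f n))" for n
      unfolding H_def by (auto split: prod.split intro: finite_imp_compact_convex_hull)
    then show "closed (H (f n))" "bounded (H (f 0))" for n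
      by (auto intro: compact_imp_closed compact_imp_bounded)
    show "H (f n) \<noteq> {}" for n by (simp add: H_def split: prod.split)
    show "H (f n) \<subseteq> H (f m)" if "m \<le> n" for m n
      using f(2) that by (rule lift_Suc_antimono_le)
  qed (use that in blast)
  have xS: "x \<in> S" using x[of 0] f(1)[of 0] unfolding P_def H_def by (auto split: prod.splits)
  have "T \<le> 0 + e" if e: "e > 0" for e :: real
  proof -
    \<comment> \<open>The summand \<open>1\<close> keeps the denominator positive for a degenerate triangle with \<open>d = 0\<close>.\<close>
    define e' where "e' = e / (6 * d\<^sup>2 + 1)"
    have e': "e' > 0" using e by (simp add: e'_def add_nonneg_pos)
    obtain r where r: "r > 0" "\<And>y. norm (y - x) < r \<Longrightarrow> norm (V y - V x - V' x (y - x)) \<le> e' * norm (y - x)"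
      using der[OF xS] e' unfolding has_derivative_at_alt by meson
    have "(\<lambda>n. 2 * (d * (1/2) ^ n)) \<longlonglongrightarrow> 2 * (d * 0)"
      by (intro tendsto_intros LIMSEQ_power_zero) simp
    then have "\<forall>\<^sub>F n in sequentially. 2 * (d * (1/2) ^ n) < r"
      by (rule order_tendstoD(2)) (simp add: r(1))
    then obtain n where n: "2 * (d * (1/2) ^ n) < r" by (auto simp: eventually_sequentially)
    obtain a1 b1 c1 where t1: "f n = (a1, b1, c1)" by (cases "f n")
    note P = f(1)[of n, unfolded P_def t1, simplified]
    have xH: "x \<in> convex hull {a1, b1, c1}" using x[of n] by (simp add: H_def t1)
    have d: "0 \<le> d" by (simp add: d_def)
    have cb: "convex hull {a1, b1, c1} \<subseteq> cball a1 (d / 2 ^ n)"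
      using P d by (intro hull_minimal) (auto simp: dist_norm norm_minus_commute)
    have small: "norm (y - x) < r" if "y \<in> convex hull {a1, b1, c1}" for y
    proof -
      have "dist a1 y \<le> d / 2 ^ n" "dist a1 x \<le> d / 2 ^ n"
        using cb that xH by auto
      then show ?thesis using n dist_triangle3[of y x a1] by (simp add: dist_norm power_one_over)
    qed
    have "\<bar>triangle_int V a1 b1 c1\<bar> \<le> 6 * e' * (d / 2 ^ n)\<^sup>2"
      using P xH r(2)[OF small] e' der[OF xS] sym[OF xS]
      by (intro triangle_int_small[OF V, where x=x and L="V' x"]) (auto intro: has_derivative_bounded_linear)
    then have "T / 4 ^ n \<le> 6 * e' * (d / 2 ^ n)\<^sup>2" using P by linarith
    also have "\<dots> = 6 * e' * d\<^sup>2 / 4 ^ n"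
      by (simp add: power_divide power_mult[symmetric] mult.commute[of n 2] power_mult)
    finally have "T \<le> e' * (6 * d\<^sup>2)" by (simp add: divide_le_cancel)
    also have "\<dots> \<le> e' * (6 * d\<^sup>2 + 1)" using e' by simp
    also have "\<dots> = e"
      using zero_le_power2[of d] by (simp add: e'_def add_nonneg_eq_0_iff)
    finally show ?thesis by simp
  qed
  then have "T \<le> 0" by (rule field_le_epsilon)
  then show ?thesis by (simp add: T_def)
qed

text \<open>The Poincare lemma for differentiable fields on simply connected domains: the triangle
  theorem makes line integrals locally additive, and the resulting primitive has gradient
  \<open>V\<close> because \<open>V\<close> is continuous.\<close>

theorem symmetric_derivative_imp_gradient:
  fixes V :: "'a::euclidean_space \<Rightarrow> 'a"
  assumes S: "open S" "simply_connected S"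
    and der: "\<And>x. x \<in> S \<Longrightarrow> (V has_derivative V' x) (at x)"
    and sym: "\<And>x u v. x \<in> S \<Longrightarrow> V' x u \<bullet> v = V' x v \<bullet> u"
  obtains \<Psi> where "\<And>x. x \<in> S \<Longrightarrow> (\<Psi> has_derivative (\<lambda>h. V x \<bullet> h)) (at x)"
proof -
  have V: "continuous_on S V"
    using der has_derivative_continuous continuous_at_imp_continuous_on by blast
  have "locally_additive S (line_int V)"
    unfolding locally_additive_def
  proof
    fix x assume "x \<in> S"
    then obtain e where e: "e > 0" "ball x e \<subseteq> S" using S(1) open_contains_ball by blast
    have "line_int V a b + line_int V b c = line_int V a c"
      if abc: "a \<in> ball x e" "b \<in> ball x e" "c \<in> ball x e" for a b c
    proof -
      have "convex hull {a, b, c} \<subseteq> S"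
        using abc e(2) hull_minimal[of "{a, b, c}" "ball x e" convex] by (auto simp: convex_ball)
      then have "triangle_int V a b c = 0"
        using goursat_symmetric_derivative[OF der sym] by blast
      moreover have "closed_segment a c \<subseteq> S"
        using closed_segment_subset[of a "ball x e" c] abc e(2) by (auto simp: convex_ball)
      ultimately show ?thesis
        using line_int_reverse[OF V, of a c] by (simp add: triangle_int_def)
    qed
    with e(1) show "\<exists>e>0. \<forall>a\<in>ball x e. \<forall>b\<in>ball x e. \<forall>c\<in>ball x e.
        line_int V a b + line_int V b c = line_int V a c" by blast
  qed
  then obtain \<Psi> where \<Psi>: "\<And>x. x \<in> S \<Longrightarrow> \<exists>e>0. \<forall>y\<in>ball x e. \<Psi> y - \<Psi> x = line_int V x y"
    using locally_additive_integrates[OF S] by blast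
  have "(\<Psi> has_derivative (\<lambda>h. V x \<bullet> h)) (at x)" if x: "x \<in> S" for x
    unfolding has_derivative_at_alt
  proof (intro conjI allI impI)
    show "bounded_linear (\<lambda>h. V x \<bullet> h)" by (rule bounded_linear_inner_right)
    fix \<epsilon> :: real assume \<epsilon>: "\<epsilon> > 0"
    obtain e1 where e1: "e1 > 0" "\<And>y. y \<in> ball x e1 \<Longrightarrow> \<Psi> y - \<Psi> x = line_int V x y"
      using \<Psi>[OF x] by blast
    obtain e2 where e2: "e2 > 0" "ball x e2 \<subseteq> S" using S(1) x open_contains_ball by blast
    obtain e3 where e3: "e3 > 0" "\<And>y. y \<in> S \<Longrightarrow> dist y x < e3 \<Longrightarrow> dist (V y) (V x) < \<epsilon>"
      using V x \<epsilon> unfolding continuous_on_iff by blast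
    have "norm (\<Psi> y - \<Psi> x - V x \<bullet> (y - x)) \<le> \<epsilon> * norm (y - x)"
      if y: "norm (y - x) < min e1 (min e2 e3)" for y
    proof -
      have seg: "closed_segment x y \<subseteq> ball x (min e2 e3)"
        using y e2(1) e3(1)
        by (intro closed_segment_subset) (auto simp: dist_norm norm_minus_commute convex_ball)
      then have seg': "closed_segment x y \<subseteq> S" using e2(2) subset_ball[of "min e2 e3" e2 x] by force
      have "\<Psi> y - \<Psi> x = line_int V x y"
        using y by (intro e1(2)) (simp add: dist_norm norm_minus_commute)
      also have "\<dots> = line_int (\<lambda>w. V w - V x) x y + line_int (\<lambda>_. V x) x y"
        using line_int_diff[OF V _ seg', of "\<lambda>_. V x"] by simp
      also have "line_int (\<lambda>_. V x) x y = V x \<bullet> (y - x)"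
        by (simp add: line_int_def)
      finally have "norm (\<Psi> y - \<Psi> x - V x \<bullet> (y - x)) = \<bar>line_int (\<lambda>w. V w - V x) x y\<bar>" by simp
      also have "\<dots> \<le> \<epsilon> * norm (y - x)"
      proof (rule line_int_bound[OF _ seg'])
        show "continuous_on S (\<lambda>w. V w - V x)" by (intro continuous_intros V)
        fix w assume "w \<in> closed_segment x y"
        then have "w \<in> S" "dist w x < e3" using seg seg' by (auto simp: dist_commute)
        then show "norm (V w - V x) \<le> \<epsilon>" using e3(2) by (auto simp: dist_norm less_imp_le)
      qed
      finally show ?thesis .
    qed
    then show "\<exists>d>0. \<forall>y. norm (y - x) < d \<longrightarrow> norm (\<Psi> y - \<Psi> x - V x \<bullet> (y - x)) \<le> \<epsilon> * norm (y - x)"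
      using e1 e2 e3 by (intro exI[of _ "min e1 (min e2 e3)"]) auto
  qed
  then show ?thesis using that by blast
qed

section \<open>Gradients on the jet space\<close>

text \<open>One step of the proof that continuous partial derivatives imply Frechet differentiability:
  the first variable is split off, and of the derivative in the remaining variables only its
  existence at the given point is used, so the step can be iterated.\<close>

lemma has_derivative_first_partial:
  fixes f :: "real \<times> 'b::real_normed_vector \<Rightarrow> real"
  assumes S: "open S" "(t, z) \<in> S"
    and D: "\<And>s w. (s, w) \<in> S \<Longrightarrow> ((\<lambda>r. f (r, w)) has_real_derivative D (s, w)) (at s)"
    and cont: "continuous_on S D"
    and f': "((\<lambda>w. f (t, w)) has_derivative f') (at z)"
  shows "(f has_derivative (\<lambda>(h, k). D (t, z) * h + f' k)) (at (t, z))"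
proof -
  obtain A B where AB: "open A" "open B" "t \<in> A" "z \<in> B" "A \<times> B \<subseteq> S"
    using open_prod_elim[OF S] by (metis mem_Times_iff fst_conv snd_conv)
  obtain e where e: "e > 0" "ball t e \<subseteq> A" using AB open_contains_ball by blast
  let ?X = "B" and ?Y = "ball t e"
  have sub: "(s, w) \<in> S" if "w \<in> ?X" "s \<in> ?Y" for s w using that AB e by blast
  \<comment> \<open>In \<open>has_derivative_partialsI\<close> the continuous partial derivative belongs to the second
    variable, so the two variables are swapped here and swapped back at the end.\<close>
  have "((\<lambda>(w, s). f (s, w)) has_derivative
      (\<lambda>(k, h). f' k + blinfun_apply (blinfun_mult_right (D (t, z))) h)) (at (z, t) within ?X \<times> ?Y)"
  proof (rule has_derivative_partialsI)
    show "((\<lambda>w. f (t, w)) has_derivative f') (at z within ?X)"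
      using f' by (rule has_derivative_at_withinI)
    show "((\<lambda>s. f (s, w)) has_derivative blinfun_apply (blinfun_mult_right (D (s, w)))) (at s within ?Y)"
      if "w \<in> ?X" "s \<in> ?Y" for w s
      using D[OF sub[OF that]] unfolding has_field_derivative_def
      by (auto intro: has_derivative_at_withinI)
    have "continuous_on (?X \<times> ?Y) (\<lambda>p. D (snd p, fst p))"
      by (rule continuous_on_compose2[OF cont]) (auto intro!: continuous_intros sub)
    then have "continuous_on (?X \<times> ?Y) (\<lambda>p. blinfun_mult_right (D (snd p, fst p)))"
      by (rule bounded_linear.continuous_on[OF bounded_linear_blinfun_mult_right])
    then show "continuous (at (z, t) within ?X \<times> ?Y) (\<lambda>(w, s). blinfun_mult_right (D (s, w)))"
      using AB e unfolding case_prod_unfold by (auto simp: continuous_on_eq_continuous_within)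
  qed (use e in \<open>auto simp: convex_ball\<close>)
  moreover have "at (z, t) within ?X \<times> ?Y = at (z, t)"
    using AB e by (intro at_within_open) (auto intro: open_Times)
  ultimately have swapped:
    "((\<lambda>(w, s). f (s, w)) has_derivative (\<lambda>(k, h). f' k + D (t, z) * h)) (at (z, t))" by simp
  have "((\<lambda>p. (snd p, fst p)) has_derivative (\<lambda>p. (snd p, fst p))) (at (t, z))"
    by (auto intro!: derivative_eq_intros)
  from has_derivative_compose[OF this, unfolded fst_conv snd_conv, OF swapped]
  show ?thesis by (simp add: case_prod_unfold add.commute)
qed

definition grad :: "(jet \<Rightarrow> real) \<Rightarrow> jet \<Rightarrow> jet" where
  "grad f x = (D_t f x, D_y f x, D_y1 f x, D_y2 f x)"

lemma C1_on_imp_has_derivative: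
  assumes R: "open R" and f: "C1_on R f" and x: "x \<in> R"
  shows "(f has_derivative (\<lambda>h. grad f x \<bullet> h)) (at x)"
proof -
  obtain t y y1 y2 where x_eq: "x = (t, y, y1, y2)" by (cases x)
  define R1 where "R1 = Pair t -` R"
  define R2 where "R2 = Pair y -` R1"
  have opn: "open R1" "open R2"
    unfolding R1_def R2_def by (intro continuous_open_vimage R continuous_intros)+
  have mem: "(y, y1, y2) \<in> R1" "(y1, y2) \<in> R2" using x by (simp_all add: R1_def R2_def x_eq)
  have df: "((\<lambda>s. f (s, b, c, d)) has_real_derivative D_t f (a, b, c, d)) (at a)"
    "((\<lambda>s. f (a, s, c, d)) has_real_derivative D_y f (a, b, c, d)) (at b)"
    "((\<lambda>s. f (a, b, s, d)) has_real_derivative D_y1 f (a, b, c, d)) (at c)"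
    "((\<lambda>s. f (a, b, c, s)) has_real_derivative D_y2 f (a, b, c, d)) (at d)"
    if "(a, b, c, d) \<in> R" for a b c d
    using f that unfolding C1_on_def D_t_def D_y_def D_y1_def D_y2_def
    by (auto simp flip: DERIV_deriv_iff_real_differentiable)
  have cont: "continuous_on R (D_t f)" "continuous_on R (D_y f)" "continuous_on R (D_y1 f)"
    using f by (auto simp: C1_on_def)
  have "((\<lambda>s. f (t, y, y1, s)) has_derivative (\<lambda>l. D_y2 f x * l)) (at y2)"
    using df(4) x by (simp add: x_eq has_field_derivative_def)
  then have d2: "((\<lambda>w. f (t, y, w)) has_derivative (\<lambda>(k, l). D_y1 f x * k + D_y2 f x * l)) (at (y1, y2))"
    unfolding x_eq
  proof (rule has_derivative_first_partial[OF opn(2) mem(2), of "\<lambda>w. f (t, y, w)" "\<lambda>w. D_y1 f (t, y, w)", rotated 2])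
    show "continuous_on R2 (\<lambda>w. D_y1 f (t, y, w))"
      by (rule continuous_on_compose2[OF cont(3)]) (auto simp: R1_def R2_def intro!: continuous_intros)
  qed (simp add: R1_def R2_def df(3))
  then have d1: "((\<lambda>w. f (t, w)) has_derivative
      (\<lambda>(h, w). D_y f x * h + (case w of (k, l) \<Rightarrow> D_y1 f x * k + D_y2 f x * l))) (at (y, y1, y2))"
    unfolding x_eq
  proof (rule has_derivative_first_partial[OF opn(1) mem(1), of "\<lambda>w. f (t, w)" "\<lambda>w. D_y f (t, w)", rotated 2])
    show "continuous_on R1 (\<lambda>w. D_y f (t, w))"
      by (rule continuous_on_compose2[OF cont(2)]) (auto simp: R1_def intro!: continuous_intros)
  qed (auto simp: R1_def df(2))
  have "(f has_derivative (\<lambda>(g, w). D_t f x * g +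
      (case w of (h, w) \<Rightarrow> D_y f x * h + (case w of (k, l) \<Rightarrow> D_y1 f x * k + D_y2 f x * l)))) (at x)"
    using d1 unfolding x_eq
    by (rule has_derivative_first_partial[OF R _ _ cont(1), rotated 2]) (use x df(1) in \<open>auto simp: x_eq\<close>)
  then show ?thesis
    by (simp add: grad_def inner_prod_def case_prod_unfold)
qed

text \<open>Conversely, a Frechet derivative determines the four partial derivatives, by restriction
  to the coordinate lines.\<close>

lemma has_derivative_imp_grad:
  assumes f: "(f has_derivative (\<lambda>h. v \<bullet> h)) (at x)"
  shows "grad f x = v"
proof -
  obtain t y y1 y2 where x: "x = (t, y, y1, y2)" by (cases x)
  obtain a b c d where v: "v = (a, b, c, d)" by (cases v)
  have slice: "((\<lambda>s. f (p s)) has_real_derivative v \<bullet> u) (at s)"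
    if "p s = x" "(p has_derivative (\<lambda>h. h *\<^sub>R u)) (at s)" for p u and s :: real
    using has_derivative_compose[OF that(2), of f "\<lambda>h. v \<bullet> h"] f that(1)
    by (simp add: has_field_derivative_def mult_commute_abs)
  have lines: "((\<lambda>s. (s, y, y1, y2)) has_derivative (\<lambda>h. (h, 0, 0, 0))) (at t)"
    "((\<lambda>s. (t, s, y1, y2)) has_derivative (\<lambda>h. (0, h, 0, 0))) (at y)"
    "((\<lambda>s. (t, y, s, y2)) has_derivative (\<lambda>h. (0, 0, h, 0))) (at y1)"
    "((\<lambda>s. (t, y, y1, s)) has_derivative (\<lambda>h. (0, 0, 0, h))) (at y2)"
    by (intro has_derivative_Pair has_derivative_const has_derivative_ident)+
  have "D_t f x = a" "D_y f x = b" "D_y1 f x = c" "D_y2 f x = d"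
    using lines slice[of "\<lambda>s. (s, y, y1, y2)" t "(1, 0, 0, 0)"] slice[of "\<lambda>s. (t, s, y1, y2)" y "(0, 1, 0, 0)"]
      slice[of "\<lambda>s. (t, y, s, y2)" y1 "(0, 0, 1, 0)"] slice[of "\<lambda>s. (t, y, y1, s)" y2 "(0, 0, 0, 1)"]
    unfolding D_t_def D_y_def D_y1_def D_y2_def
    by (auto simp: x v inner_prod_def DERIV_imp_deriv)
  then show ?thesis by (simp add: grad_def v)
qed

text \<open>The coefficients of the total derivative of \<open>\<Psi>\<close> are its partial derivatives, so a
  potential of the field \<open>(F0, F1, F2, F3)\<close> witnesses exactness.\<close>

lemma exact_ode_of_symmetric_derivative:
  assumes R: "open R" "simply_connected R"
    and der: "\<And>x. x \<in> R \<Longrightarrow> ((\<lambda>x. (F0 x, F1 x, F2 x, F3 x)) has_derivative V' x) (at x)"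
    and sym: "\<And>x u v. x \<in> R \<Longrightarrow> V' x u \<bullet> v = V' x v \<bullet> u"
  shows "exact_ode R F0 F1 F2 F3"
proof -
  obtain \<Psi> where \<Psi>: "\<And>x. x \<in> R \<Longrightarrow> (\<Psi> has_derivative (\<lambda>h. (F0 x, F1 x, F2 x, F3 x) \<bullet> h)) (at x)"
    using symmetric_derivative_imp_gradient[OF R der sym] by blast
  have "\<Psi> differentiable_on R"
    using \<Psi> has_derivative_at_withinI unfolding differentiable_on_def differentiable_def by blast
  moreover have "total_deriv \<Psi> x y3 = ode_lhs F0 F1 F2 F3 x y3" if "x \<in> R" for x y3
    using has_derivative_imp_grad[OF \<Psi>[OF that]]
    by (cases x) (simp add: grad_def total_deriv_def ode_lhs_def)
  ultimately show ?thesis unfolding exact_ode_def by blast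
qed

lemma has_derivative_product_of_variables:
  fixes \<alpha> \<beta> \<gamma> \<delta> :: "real \<Rightarrow> real"
  assumes "\<alpha> differentiable at t" "\<beta> differentiable at y" "\<gamma> differentiable at y1" "\<delta> differentiable at y2"
  shows "((\<lambda>(t, y, y1, y2). \<alpha> t * \<beta> y * \<gamma> y1 * \<delta> y2) has_derivative
     (\<lambda>h. (deriv \<alpha> t * \<beta> y * \<gamma> y1 * \<delta> y2, \<alpha> t * deriv \<beta> y * \<gamma> y1 * \<delta> y2,
           \<alpha> t * \<beta> y * deriv \<gamma> y1 * \<delta> y2, \<alpha> t * \<beta> y * \<gamma> y1 * deriv \<delta> y2) \<bullet> h)) (at (t, y, y1, y2))"
proof -
  have d: "(\<alpha> has_real_derivative deriv \<alpha> t) (at t)" "(\<beta> has_real_derivative deriv \<beta> y) (at y)"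
    "(\<gamma> has_real_derivative deriv \<gamma> y1) (at y1)" "(\<delta> has_real_derivative deriv \<delta> y2) (at y2)"
    using assms by (auto simp: DERIV_deriv_iff_real_differentiable)
  have c: "((\<lambda>x. f (p x)) has_derivative (\<lambda>h. deriv f (p x) * p h)) (at x)"
    if "(f has_real_derivative deriv f (p x)) (at (p x))" "bounded_linear p" for f p and x :: jet
    using has_derivative_compose[OF bounded_linear_imp_has_derivative[OF that(2)], of f "\<lambda>h. deriv f (p x) * h"]
      that(1) by (simp add: has_field_derivative_def)
  let ?x = "(t, y, y1, y2)"
  note snd2 = bounded_linear_compose[OF bounded_linear_snd bounded_linear_snd]
  note bl = bounded_linear_fst bounded_linear_compose[OF bounded_linear_fst bounded_linear_snd]
    bounded_linear_compose[OF bounded_linear_fst snd2] bounded_linear_compose[OF bounded_linear_snd snd2]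
  have d': "((\<lambda>x. \<alpha> (fst x)) has_derivative (\<lambda>h. deriv \<alpha> t * fst h)) (at ?x)"
    "((\<lambda>x. \<beta> (fst (snd x))) has_derivative (\<lambda>h. deriv \<beta> y * fst (snd h))) (at ?x)"
    "((\<lambda>x. \<gamma> (fst (snd (snd x)))) has_derivative (\<lambda>h. deriv \<gamma> y1 * fst (snd (snd h)))) (at ?x)"
    "((\<lambda>x. \<delta> (snd (snd (snd x)))) has_derivative (\<lambda>h. deriv \<delta> y2 * snd (snd (snd h)))) (at ?x)"
    using c[OF _ bl(1), of \<alpha> ?x, unfolded fst_conv snd_conv, OF d(1)]
      c[OF _ bl(2), of \<beta> ?x, unfolded fst_conv snd_conv, OF d(2)]
      c[OF _ bl(3), of \<gamma> ?x, unfolded fst_conv snd_conv, OF d(3)]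
      c[OF _ bl(4), of \<delta> ?x, unfolded fst_conv snd_conv, OF d(4)] .
  have "((\<lambda>x. \<alpha> (fst x) * \<beta> (fst (snd x)) * \<gamma> (fst (snd (snd x))) * \<delta> (snd (snd (snd x)))) has_derivative
     (\<lambda>h. (deriv \<alpha> t * \<beta> y * \<gamma> y1 * \<delta> y2, \<alpha> t * deriv \<beta> y * \<gamma> y1 * \<delta> y2,
           \<alpha> t * \<beta> y * deriv \<gamma> y1 * \<delta> y2, \<alpha> t * \<beta> y * \<gamma> y1 * deriv \<delta> y2) \<bullet> h)) (at ?x)"
    by (rule has_derivative_mult[OF has_derivative_mult[OF has_derivative_mult[OF d'(1,2)] d'(3)] d'(4),
          THEN has_derivative_eq_rhs])
       (simp add: inner_prod_def algebra_simps fun_eq_iff)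
  then show ?thesis by (simp add: case_prod_unfold)
qed

section \<open>Antiderivatives on open intervals and compositions on the line\<close>

lemma antiderivative_on_open_connected:
  fixes g :: "real \<Rightarrow> real"
  assumes I: "open I" "connected I" and g: "continuous_on I g"
  obtains G where "\<And>s. s \<in> I \<Longrightarrow> (G has_real_derivative g s) (at s)"
proof -
  define a b where "a = (INF s\<in>I. ereal s)" and "b = (SUP s\<in>I. ereal s)"
  have ab: "a < ereal s" "ereal s < b" if s: "s \<in> I" for s
  proof -
    obtain e where e: "e > 0" "cball s e \<subseteq> I" using I(1) s open_contains_cball by blast
    then have "s - e \<in> I" "s + e \<in> I" by (auto simp: dist_real_def)
    then have "a \<le> ereal (s - e)" "ereal (s + e) \<le> b"
      unfolding a_def b_def by (auto intro: INF_lower SUP_upper)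
    moreover have "ereal (s - e) < ereal s" "ereal s < ereal (s + e)" using e by auto
    ultimately show "a < ereal s" "ereal s < b" by (meson order_le_less_trans order_less_le_trans)+
  qed
  have inI: "s \<in> I" if s: "a < ereal s" "ereal s < b" for s
  proof -
    obtain p q where "p \<in> I" "p < s" "q \<in> I" "s < q"
      using s unfolding a_def b_def INF_less_iff less_SUP_iff by auto
    then show ?thesis using connected_contains_Icc[OF I(2), of p q] by auto
  qed
  have cont: "isCont g s" if "a < ereal s" "ereal s < b" for s
    using inI[OF that] g I(1) by (simp add: continuous_on_eq_continuous_at)
  show ?thesis
  proof (cases "I = {}")
    case False
    then have "a < b" using ab by (meson ex_in_conv order_less_trans)
    then show ?thesis
      using einterval_antiderivative[OF _ cont, of a b] ab that
      by (metis has_real_derivative_iff_has_vector_derivative)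
  qed (use that in auto)
qed

text \<open>If \<open>\<phi>' t \<noteq> 0\<close>, small neighbourhoods of \<open>t\<close> are mapped onto neighbourhoods of \<open>\<phi> t\<close>, even
  if \<open>\<phi>'\<close> is discontinuous and \<open>\<phi>\<close> is not injective near \<open>t\<close>. Hence continuity of \<open>g \<circ> \<phi>\<close>
  descends to \<open>g\<close>.\<close>

lemma isCont_outer_at_regular_point:
  fixes g \<phi> :: "real \<Rightarrow> real"
  assumes U: "open U" "t \<in> U" and \<phi>: "continuous_on U \<phi>"
    and c: "(\<phi> has_real_derivative c) (at t)" "c \<noteq> 0"
    and g: "continuous_on U (\<lambda>s. g (\<phi> s))"
  shows "\<phi> t \<in> interior (\<phi> ` U)" and "isCont g (\<phi> t)"
proof -
  have inner: "\<phi> t \<in> interior (\<phi> ` T)" if "T \<subseteq> U" "open T" "t \<in> T" for T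
  proof (rule sussmann_open_mapping[OF U(1) \<phi> U(2), where f'="(*) c" and g'="\<lambda>h. h / c"])
    show "(\<phi> has_derivative (*) c) (at t)" using c(1) by (simp add: has_field_derivative_def)
    show "bounded_linear (\<lambda>h. h / c)" by (rule bounded_linear_divide)
    show "(*) c \<circ> (\<lambda>h. h / c) = id" using c(2) by auto
  qed (use that in \<open>auto simp: interior_open\<close>)
  show "\<phi> t \<in> interior (\<phi> ` U)" using inner U by blast
  show "isCont g (\<phi> t)"
    unfolding isCont_def tendsto_iff
  proof (intro allI impI)
    fix e :: real assume e: "e > 0"
    obtain d where d: "d > 0" "\<And>s. s \<in> U \<Longrightarrow> dist s t < d \<Longrightarrow> dist (g (\<phi> s)) (g (\<phi> t)) < e"
      using g U(2) e unfolding continuous_on_iff by blast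
    let ?T = "U \<inter> ball t d"
    have "\<phi> t \<in> interior (\<phi> ` ?T)" using U d by (intro inner) auto
    moreover have "dist (g v) (g (\<phi> t)) < e" if "v \<in> interior (\<phi> ` ?T)" for v
      using that interior_subset[of "\<phi> ` ?T"] d(2) by (force simp: dist_commute)
    ultimately show "\<forall>\<^sub>F v in at (\<phi> t). dist (g v) (g (\<phi> t)) < e"
      unfolding eventually_at_topological using open_interior by blast
  qed
qed

section \<open>Integrating factors depending on a product of functions of one variable\<close>

text \<open>The derivative of \<open>\<mu> F\<^sub>j\<close> with \<open>\<mu> = exp (G \<circ> \<xi>)\<close> is \<open>\<mu> (dF\<^sub>j + q F\<^sub>j d\<xi>)\<close>, and the six
  equations \<open>n = q d\<close> express exactly that the matrix of these derivatives is symmetric.\<close>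

lemma exp_indefinite_integral_is_integrating_factor:
  assumes R: "open R" "simply_connected R"
    and C1: "C1_on R F0" "C1_on R F1" "C1_on R F2" "C1_on R F3"
    and \<xi>: "\<And>x. x \<in> R \<Longrightarrow> (\<xi> has_derivative (\<lambda>h. grad \<xi> x \<bullet> h)) (at x)"
    and G: "indefinite_integral_wrt R \<xi> q G"
    and q: "\<forall>(n, d) \<in> quotient_terms F0 F1 F2 F3 \<xi>. \<forall>x\<in>R. n x = q x * d x"
  shows "integrating_factor R F0 F1 F2 F3 (\<lambda>x. exp (G (\<xi> x)))"
  unfolding integrating_factor_def
proof (rule exact_ode_of_symmetric_derivative[OF R])
  let ?\<mu> = "\<lambda>x. exp (G (\<xi> x))"
  let ?D = "\<lambda>F x h. ?\<mu> x * (grad F x \<bullet> h + q x * (grad \<xi> x \<bullet> h) * F x)"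
  fix x assume x: "x \<in> R"
  have "((\<lambda>x. G (\<xi> x)) has_derivative (\<lambda>h. q x * (grad \<xi> x \<bullet> h))) (at x)"
    using has_derivative_compose[OF \<xi>[OF x]] G x
    unfolding indefinite_integral_wrt_def has_field_derivative_def by blast
  then have \<mu>: "(?\<mu> has_derivative (\<lambda>h. ?\<mu> x * (q x * (grad \<xi> x \<bullet> h)))) (at x)"
    by (rule has_derivative_exp[THEN has_derivative_eq_rhs]) (simp add: fun_eq_iff mult.commute)
  have D: "((\<lambda>x. ?\<mu> x * F x) has_derivative ?D F x) (at x)" if "C1_on R F" for F
    by (rule has_derivative_mult[OF \<mu> C1_on_imp_has_derivative[OF R(1) that x], THEN has_derivative_eq_rhs])
       (simp add: fun_eq_iff algebra_simps)
  show "((\<lambda>x. (?\<mu> x * F0 x, ?\<mu> x * F1 x, ?\<mu> x * F2 x, ?\<mu> x * F3 x)) has_derivative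
      (\<lambda>h. (?D F0 x h, ?D F1 x h, ?D F2 x h, ?D F3 x h))) (at x)"
    by (intro has_derivative_Pair D C1)
  fix u v :: jet
  obtain u0 u1 u2 u3 v0 v1 v2 v3 where uv: "u = (u0, u1, u2, u3)" "v = (v0, v1, v2, v3)"
    by (cases u, cases v)
  have "D_t F3 x - D_y2 F0 x = q x * (D_y2 \<xi> x * F0 x - D_t \<xi> x * F3 x)"
    "D_t F2 x - D_y1 F0 x = q x * (D_y1 \<xi> x * F0 x - D_t \<xi> x * F2 x)"
    "D_t F1 x - D_y F0 x = q x * (D_y \<xi> x * F0 x - D_t \<xi> x * F1 x)"
    "D_y1 F1 x - D_y F2 x = q x * (D_y \<xi> x * F2 x - D_y1 \<xi> x * F1 x)"
    "D_y2 F1 x - D_y F3 x = q x * (D_y \<xi> x * F3 x - D_y2 \<xi> x * F1 x)"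
    "D_y2 F2 x - D_y1 F3 x = q x * (D_y1 \<xi> x * F3 x - D_y2 \<xi> x * F2 x)"
    using q x by (simp_all add: quotient_terms_def)
  \<comment> \<open>Solved for the terms \<open>\<partial>\<^sub>i F\<^sub>j\<close> with \<open>i < j\<close>, the equations serve as rewrite rules that
    leave a polynomial identity.\<close>
  then have mixed:
    "D_t F3 x = D_y2 F0 x + q x * (D_y2 \<xi> x * F0 x - D_t \<xi> x * F3 x)"
    "D_t F2 x = D_y1 F0 x + q x * (D_y1 \<xi> x * F0 x - D_t \<xi> x * F2 x)"
    "D_t F1 x = D_y F0 x + q x * (D_y \<xi> x * F0 x - D_t \<xi> x * F1 x)"
    "D_y F2 x = D_y1 F1 x - q x * (D_y \<xi> x * F2 x - D_y1 \<xi> x * F1 x)"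
    "D_y F3 x = D_y2 F1 x - q x * (D_y \<xi> x * F3 x - D_y2 \<xi> x * F1 x)"
    "D_y1 F3 x = D_y2 F2 x - q x * (D_y1 \<xi> x * F3 x - D_y2 \<xi> x * F2 x)"
    by linarith+
  have "(grad F0 x \<bullet> u + q x * (grad \<xi> x \<bullet> u) * F0 x) * v0 + (grad F1 x \<bullet> u + q x * (grad \<xi> x \<bullet> u) * F1 x) * v1
      + (grad F2 x \<bullet> u + q x * (grad \<xi> x \<bullet> u) * F2 x) * v2 + (grad F3 x \<bullet> u + q x * (grad \<xi> x \<bullet> u) * F3 x) * v3
      = (grad F0 x \<bullet> v + q x * (grad \<xi> x \<bullet> v) * F0 x) * u0 + (grad F1 x \<bullet> v + q x * (grad \<xi> x \<bullet> v) * F1 x) * u1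
      + (grad F2 x \<bullet> v + q x * (grad \<xi> x \<bullet> v) * F2 x) * u2 + (grad F3 x \<bullet> v + q x * (grad \<xi> x \<bullet> v) * F3 x) * u3"
    unfolding grad_def uv by (simp add: inner_prod_def mixed) algebra
  moreover have "(m * a, m * b, m * c, m * d) \<bullet> v = m * (a * v0 + b * v1 + c * v2 + d * v3)"
    "(m * a, m * b, m * c, m * d) \<bullet> u = m * (a * u0 + b * u1 + c * u2 + d * u3)" for m a b c d :: real
    unfolding uv by (simp_all add: inner_prod_def distrib_left mult.assoc add.assoc)
  ultimately show "(?D F0 x u, ?D F1 x u, ?D F2 x u, ?D F3 x u) \<bullet> v = (?D F0 x v, ?D F1 x v, ?D F2 x v, ?D F3 x v) \<bullet> u"
    by (simp only:)
qed

text \<open>As the denominator \<open>\<xi>\<^sub>y F\<^sub>0 - \<xi>\<^sub>t F\<^sub>1\<close> has no zero, \<open>\<xi>\<^sub>t \<noteq> 0\<close> or \<open>\<xi>\<^sub>y \<noteq> 0\<close> at each point.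
  In the first case only \<open>t\<close> is varied, and \<open>g\<close> is computed from the quotient for the pair
  \<open>y, y'\<close>, which contains \<open>\<alpha>\<close> but not \<open>\<alpha>'\<close>; in the second case only \<open>y\<close> is varied, and the
  quotient for \<open>t, y''\<close> contains \<open>\<beta>\<close> but not \<open>\<beta>'\<close>. Either way \<open>g\<close> is continuous at the value
  of \<open>\<xi>\<close>, and this value is interior to the range.\<close>

lemma indefinite_integral_exists:
  fixes R :: "jet set"
    and \<xi> :: "jet \<Rightarrow> real" and \<alpha> \<beta> \<gamma> \<delta> :: "real \<Rightarrow> real"
  assumes R: "open R" "connected R"
    and C1: "C1_on R F0" "C1_on R F1" "C1_on R F2" "C1_on R F3"
    and diff: "\<forall>(t, y, y1, y2) \<in> R. \<alpha> differentiable at t \<and> \<beta> differentiable at y \<and>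
                 \<gamma> differentiable at y1 \<and> \<delta> differentiable at y2"
    and \<xi>: "\<xi> = (\<lambda>(t, y, y1, y2). \<alpha> t * \<beta> y * \<gamma> y1 * \<delta> y2)"
    and nz: "\<And>n d x. (n, d) \<in> quotient_terms F0 F1 F2 F3 \<xi> \<Longrightarrow> x \<in> R \<Longrightarrow> d x \<noteq> 0"
    and g: "\<And>n d x. (n, d) \<in> quotient_terms F0 F1 F2 F3 \<xi> \<Longrightarrow> x \<in> R \<Longrightarrow> n x / d x = g (\<xi> x)"
  obtains G where "indefinite_integral_wrt R \<xi> (\<lambda>x. g (\<xi> x)) G"
proof -
  have \<xi>': "(\<xi> has_derivative (\<lambda>h.
      (deriv \<alpha> t * \<beta> y * \<gamma> y1 * \<delta> y2, \<alpha> t * deriv \<beta> y * \<gamma> y1 * \<delta> y2,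
       \<alpha> t * \<beta> y * deriv \<gamma> y1 * \<delta> y2, \<alpha> t * \<beta> y * \<gamma> y1 * deriv \<delta> y2) \<bullet> h)) (at (t, y, y1, y2))"
    if "(t, y, y1, y2) \<in> R" for t y y1 y2
    unfolding \<xi> using diff that by (intro has_derivative_product_of_variables) auto
  have D\<xi>: "D_t \<xi> (t, y, y1, y2) = deriv \<alpha> t * \<beta> y * \<gamma> y1 * \<delta> y2"
    "D_y \<xi> (t, y, y1, y2) = \<alpha> t * deriv \<beta> y * \<gamma> y1 * \<delta> y2"
    "D_y1 \<xi> (t, y, y1, y2) = \<alpha> t * \<beta> y * deriv \<gamma> y1 * \<delta> y2"
    "D_y2 \<xi> (t, y, y1, y2) = \<alpha> t * \<beta> y * \<gamma> y1 * deriv \<delta> y2"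
    if "(t, y, y1, y2) \<in> R" for t y y1 y2
    using has_derivative_imp_grad[OF \<xi>'[OF that]] by (simp_all add: grad_def)
  have C: "continuous_on R F0" "continuous_on R F1" "continuous_on R F2" "continuous_on R F3"
    "continuous_on R (D_t F3)" "continuous_on R (D_y2 F0)"
    "continuous_on R (D_y1 F1)" "continuous_on R (D_y F2)"
    using C1 by (auto simp: C1_on_def)
  have along: "\<xi> (p s) \<in> interior (\<xi> ` R) \<and> isCont g (\<xi> (p s))"
    if nd: "(n, d) \<in> quotient_terms F0 F1 F2 F3 \<xi>" and p: "continuous_on UNIV p" "p s \<in> R"
      and cont: "continuous_on (p -` R) (\<lambda>s. n (p s))" "continuous_on (p -` R) (\<lambda>s. d (p s))"
        "continuous_on (p -` R) (\<lambda>s. \<xi> (p s))"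
      and der: "((\<lambda>s. \<xi> (p s)) has_real_derivative c) (at s)" "c \<noteq> 0"
    for n d s c and p :: "real \<Rightarrow> jet"
  proof -
    have U: "open (p -` R)" "s \<in> p -` R" using p R by (auto intro: open_vimage)
    have "continuous_on (p -` R) (\<lambda>s. n (p s) / d (p s))"
      using nz[OF nd] by (intro continuous_on_divide cont) auto
    then have "continuous_on (p -` R) (\<lambda>s. g (\<xi> (p s)))"
      by (rule continuous_on_eq) (simp add: g[OF nd])
    from isCont_outer_at_regular_point[OF U cont(3) der this]
    have "\<xi> (p s) \<in> interior ((\<lambda>s. \<xi> (p s)) ` (p -` R))" "isCont g (\<xi> (p s))" by auto
    moreover have "(\<lambda>s. \<xi> (p s)) ` (p -` R) \<subseteq> \<xi> ` R" by blast
    ultimately show ?thesis using interior_mono by blast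
  qed
  have step: "\<xi> x \<in> interior (\<xi> ` R) \<and> isCont g (\<xi> x)" if x: "x \<in> R" for x
  proof -
    obtain t y y1 y2 where x_eq: "x = (t, y, y1, y2)" by (cases x)
    have d: "\<alpha> differentiable at t" "\<beta> differentiable at y" using diff x x_eq by auto
    have "D_y \<xi> x * F0 x - D_t \<xi> x * F1 x \<noteq> 0"
      using nz[OF _ x, of "\<lambda>x. D_t F1 x - D_y F0 x" "\<lambda>x. D_y \<xi> x * F0 x - D_t \<xi> x * F1 x"]
      by (simp add: quotient_terms_def)
    then consider "D_t \<xi> x \<noteq> 0" | "D_y \<xi> x \<noteq> 0" by fastforce
    then show ?thesis
    proof cases
      case 1
      let ?p = "\<lambda>s. (s, y, y1, y2)"
      let ?n = "\<lambda>x. D_y1 F1 x - D_y F2 x" and ?d = "\<lambda>x. D_y \<xi> x * F2 x - D_y1 \<xi> x * F1 x"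
      have p: "continuous_on A ?p" for A by (intro continuous_intros)
      have slice: "continuous_on (?p -` R) (\<lambda>s. f (?p s))" if "continuous_on R f" for f :: "jet \<Rightarrow> real"
        by (rule continuous_on_compose2[OF that p]) auto
      have \<alpha>: "continuous_on (?p -` R) \<alpha>"
        using diff by (intro continuous_at_imp_continuous_on ballI differentiable_imp_continuous_within) auto
      have "\<xi> (?p t) \<in> interior (\<xi> ` R) \<and> isCont g (\<xi> (?p t))"
      proof (rule along[of ?n ?d ?p t "D_t \<xi> x"])
        show "(?n, ?d) \<in> quotient_terms F0 F1 F2 F3 \<xi>" by (simp add: quotient_terms_def)
        show "continuous_on (?p -` R) (\<lambda>s. ?n (?p s))" by (intro continuous_intros slice C)
        have "continuous_on (?p -` R) (\<lambda>s. \<alpha> s * deriv \<beta> y * \<gamma> y1 * \<delta> y2 * F2 (?p s)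
              - \<alpha> s * \<beta> y * deriv \<gamma> y1 * \<delta> y2 * F1 (?p s))"
          by (intro continuous_intros \<alpha> slice C)
        then show "continuous_on (?p -` R) (\<lambda>s. ?d (?p s))"
          by (rule continuous_on_eq) (simp add: D\<xi>)
        show "continuous_on (?p -` R) (\<lambda>s. \<xi> (?p s))"
          unfolding \<xi> prod.case by (intro continuous_intros \<alpha>)
        show "((\<lambda>s. \<xi> (?p s)) has_real_derivative D_t \<xi> x) (at t)"
          unfolding x_eq D\<xi>(1)[OF x[unfolded x_eq]] using d(1)
          by (auto simp: \<xi> simp flip: DERIV_deriv_iff_real_differentiable intro!: derivative_eq_intros)
      qed (use 1 x p in \<open>auto simp: x_eq\<close>)
      then show ?thesis by (simp add: x_eq)
    next
      case 2
      let ?p = "\<lambda>s. (t, s, y1, y2)"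
      let ?n = "\<lambda>x. D_t F3 x - D_y2 F0 x" and ?d = "\<lambda>x. D_y2 \<xi> x * F0 x - D_t \<xi> x * F3 x"
      have p: "continuous_on A ?p" for A by (intro continuous_intros)
      have slice: "continuous_on (?p -` R) (\<lambda>s. f (?p s))" if "continuous_on R f" for f :: "jet \<Rightarrow> real"
        by (rule continuous_on_compose2[OF that p]) auto
      have \<beta>: "continuous_on (?p -` R) \<beta>"
        using diff by (intro continuous_at_imp_continuous_on ballI differentiable_imp_continuous_within) auto
      have "\<xi> (?p y) \<in> interior (\<xi> ` R) \<and> isCont g (\<xi> (?p y))"
      proof (rule along[of ?n ?d ?p y "D_y \<xi> x"])
        show "(?n, ?d) \<in> quotient_terms F0 F1 F2 F3 \<xi>" by (simp add: quotient_terms_def)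
        show "continuous_on (?p -` R) (\<lambda>s. ?n (?p s))" by (intro continuous_intros slice C)
        have "continuous_on (?p -` R) (\<lambda>s. \<alpha> t * \<beta> s * \<gamma> y1 * deriv \<delta> y2 * F0 (?p s)
              - deriv \<alpha> t * \<beta> s * \<gamma> y1 * \<delta> y2 * F3 (?p s))"
          by (intro continuous_intros \<beta> slice C)
        then show "continuous_on (?p -` R) (\<lambda>s. ?d (?p s))"
          by (rule continuous_on_eq) (simp add: D\<xi>)
        show "continuous_on (?p -` R) (\<lambda>s. \<xi> (?p s))"
          unfolding \<xi> prod.case by (intro continuous_intros \<beta>)
        show "((\<lambda>s. \<xi> (?p s)) has_real_derivative D_y \<xi> x) (at y)"
          unfolding x_eq D\<xi>(2)[OF x[unfolded x_eq]] using d(2)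
          by (auto simp: \<xi> simp flip: DERIV_deriv_iff_real_differentiable intro!: derivative_eq_intros)
      qed (use 2 x p in \<open>auto simp: x_eq\<close>)
      then show ?thesis by (simp add: x_eq)
    qed
  qed
  have "continuous_on R \<xi>"
  proof (intro continuous_at_imp_continuous_on ballI)
    show "isCont \<xi> x" if "x \<in> R" for x
      using has_derivative_continuous[OF \<xi>'] that by (cases x) simp
  qed
  then have "connected (\<xi> ` R)" using R(2) connected_continuous_image by blast
  moreover have "\<xi> ` R \<subseteq> interior (\<xi> ` R)" using step by blast
  then have "open (\<xi> ` R)" by (metis interior_subset open_interior subset_antisym)
  moreover have "continuous_on (\<xi> ` R) g"
    using step by (auto intro!: continuous_at_imp_continuous_on)
  ultimately obtain G where "\<And>s. s \<in> \<xi> ` R \<Longrightarrow> (G has_real_derivative g s) (at s)"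
    using antiderivative_on_open_connected by metis
  then show ?thesis by (intro that[of G]) (simp add: indefinite_integral_wrt_def)
qed

theorem theorem2p1:
  fixes R :: "jet set"
    and F0 F1 F2 F3 \<xi> :: "jet \<Rightarrow> real"
    and \<alpha> \<beta> \<gamma> \<delta> :: "real \<Rightarrow> real"
  assumes domain: "open R" "connected R" "simply_connected R"
    and C1: "C1_on R F0" "C1_on R F1" "C1_on R F2" "C1_on R F3"
    and not_exact: "\<not> exact_ode R F0 F1 F2 F3"
    and diff: "\<forall>(t, y, y1, y2) \<in> R. \<alpha> differentiable at t \<and> \<beta> differentiable at y \<and>
                 \<gamma> differentiable at y1 \<and> \<delta> differentiable at y2"
    and xi: "\<xi> = (\<lambda>(t, y, y1, y2). \<alpha> t * \<beta> y * \<gamma> y1 * \<delta> y2)"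
    and defined: "\<forall>(n, d) \<in> quotient_terms F0 F1 F2 F3 \<xi>. \<forall>x\<in>R. d x \<noteq> 0"
    and a: "\<forall>(n, d) \<in> quotient_terms F0 F1 F2 F3 \<xi>. function_of R \<xi> (\<lambda>x. n x / d x)"
    and b: "\<forall>(n, d) \<in> quotient_terms F0 F1 F2 F3 \<xi>. \<forall>(n', d') \<in> quotient_terms F0 F1 F2 F3 \<xi>.
              \<forall>x\<in>R. n x / d x = n' x / d' x"
  shows "let q = (\<lambda>x. (D_t F3 x - D_y2 F0 x) / (D_y2 \<xi> x * F0 x - D_t \<xi> x * F3 x)) in
    (\<exists>\<mu> :: real \<Rightarrow> real. integrating_factor R F0 F1 F2 F3 (\<lambda>x. \<mu> (\<xi> x)) \<and>
       (\<exists>G. indefinite_integral_wrt R \<xi> q G \<and> (\<forall>s. \<mu> s = exp (G s)))) \<and>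
    (\<forall>G. indefinite_integral_wrt R \<xi> q G \<longrightarrow>
       integrating_factor R F0 F1 F2 F3 (\<lambda>x. exp (G (\<xi> x))))"
proof -
  define q where "q x = (D_t F3 x - D_y2 F0 x) / (D_y2 \<xi> x * F0 x - D_t \<xi> x * F3 x)" for x
  have first: "(\<lambda>x. D_t F3 x - D_y2 F0 x, \<lambda>x. D_y2 \<xi> x * F0 x - D_t \<xi> x * F3 x)
      \<in> quotient_terms F0 F1 F2 F3 \<xi>"
    by (simp add: quotient_terms_def)
  have nz: "d x \<noteq> 0" if "(n, d) \<in> quotient_terms F0 F1 F2 F3 \<xi>" "x \<in> R" for n d x
    using defined that by blast
  have quot: "n x / d x = q x" if "(n, d) \<in> quotient_terms F0 F1 F2 F3 \<xi>" "x \<in> R" for n d x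
    using bspec[OF b that(1)] first that(2) unfolding q_def by fastforce
  obtain g where g: "\<And>x. x \<in> R \<Longrightarrow> q x = g (\<xi> x)"
    using bspec[OF a first] unfolding function_of_def q_def by auto
  have \<xi>': "(\<xi> has_derivative (\<lambda>h. grad \<xi> x \<bullet> h)) (at x)" if "x \<in> R" for x
  proof -
    obtain t y y1 y2 where x_eq: "x = (t, y, y1, y2)" by (cases x)
    have "\<alpha> differentiable at t" "\<beta> differentiable at y" "\<gamma> differentiable at y1" "\<delta> differentiable at y2"
      using diff that by (auto simp: x_eq)
    note der = has_derivative_product_of_variables[OF this, folded xi x_eq]
    show ?thesis using der unfolding has_derivative_imp_grad[OF der] .
  qed
  have factor: "integrating_factor R F0 F1 F2 F3 (\<lambda>x. exp (G (\<xi> x)))"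
    if "indefinite_integral_wrt R \<xi> q G" for G
    using domain(1,3) C1 \<xi>' that
  proof (rule exp_indefinite_integral_is_integrating_factor)
    show "\<forall>(n, d) \<in> quotient_terms F0 F1 F2 F3 \<xi>. \<forall>x\<in>R. n x = q x * d x"
      using nz by (auto simp flip: quot)
  qed
  obtain G where "indefinite_integral_wrt R \<xi> (\<lambda>x. g (\<xi> x)) G"
  proof (rule indefinite_integral_exists[OF domain(1,2) C1 diff xi, of g])
    show "d x \<noteq> 0" "n x / d x = g (\<xi> x)"
      if "(n, d) \<in> quotient_terms F0 F1 F2 F3 \<xi>" "x \<in> R" for n d x
      using nz[OF that] quot[OF that] g[OF that(2)] by simp_all
  qed
  then have G: "indefinite_integral_wrt R \<xi> q G"
    using g by (simp add: indefinite_integral_wrt_def)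
  show ?thesis unfolding Let_def q_def[abs_def, symmetric]
    by (intro conjI exI[of _ "\<lambda>s. exp (G s)"] allI impI exI[of _ G] factor G refl)
qed

end
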